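(* Let $\Omega\subseteq\mathbb{H}$ be a speared domain, let $f:\Omega\to\mathbb{H}$ be a slice regular function and let $\{F^J:D^J\to\mathbb{H}_{\mathbb{C}}\}_{J\in\mathbb{S}}$ be the holomorphic stem family associated to $f$. Let $\alpha_0,\beta_0\in\mathbb{R}$ (with $\beta_0\geq0$) and $I,I'\in\mathbb{S}$ be such that $x=\alpha_0+\beta_0I$ and $x'=\alpha_0+\beta_0I'$ belong to $\Omega$. If $x\sim x'$ (that is, $x'$ is hinged to $x$ in $\Omega$), then there exists an open neighborhood $U$ of $\alpha_0+\beta_0\imath$ in $D^{I,I'}$ where $F^I$ and $F^{I'}$ coincide. As a consequence, for all $\alpha,\beta\in\mathbb{R}$ with $\beta\geq0$ such that $\alpha+\beta\imath\in U$, the equality $f^\circ_s(\alpha+\beta I)=f^\circ_s(\alpha+\beta I')$ holds, and the equality $f'_s(\alpha+\beta I)=f'_s(\alpha+\beta I')$ holds provided $\beta>0$.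
   Context: Basic notation. $\mathbb{H}$ is the algebra of quaternions (Euclidean topology), $\mathbb{S}=\{w\in\mathbb{H}: w^2=-1\}$. For $I\in\mathbb{S}$: $\mathbb{C}_I=\mathbb{R}+\mathbb{R}I$, $\mathbb{C}_I^{\geqslant}=\{\alpha+\beta I:\alpha,\beta\in\mathbb{R},\beta\ge0\}$. For $T\subseteq\mathbb{H}$: $T_I=T\cap\mathbb{C}_I$, $T_I^{\geqslant}=T\cap\mathbb{C}_I^{\geqslant}$. For $x=\alpha+\beta I$, $\mathbb{S}_x=\alpha+\beta\mathbb{S}$. A domain is a nonempty connected open subset of $\mathbb{H}$. A function $f:\Omega\to\mathbb{H}$ on a domain is slice regular if for every $I\in\mathbb{S}$ the restriction $f_{|\Omega_I}$ is $C^1$ and $\left(\frac{\partial}{\partial\alpha}+I\frac{\partial}{\partial\beta}\right)f(\alpha+\beta I)=0$ on $\Omega_I$. An open $U\subseteq\mathbb{H}$ is speared if, for all $I\in\mathbb{S}$, each connected component of $U_I^{\geqslant}$ includes a real point. A speared domain is a domain that is a speared open set. A set $T\subseteq\mathbb{H}$ is symmetric if $\alpha+\beta I\in T$ implies $\alpha+\beta\mathbb{S}\subseteq T$; $\mathrm{core}(U)$ is the largest symmetric speared open subset of the open set $U$. Stem functions. $\mathbb{H}_{\mathbb{C}}=\mathbb{H}\otimes_{\mathbb{R}}\mathbb{C}=\{x+\imath y: x,y\in\mathbb{H}\}$, with $\imath$ central and $\imath^2=-1$; $\overline{x+\imath y}=x-\imath y$; $\mathbb{R}_{\mathbb{C}}=\mathbb{R}+\imath\mathbb{R}$.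 For $E\subseteq\mathbb{R}_{\mathbb{C}}$, $\overline E$ is its image under conjugation. For $J\in\mathbb{S}$, $\phi_J:\mathbb{R}_{\mathbb{C}}\to\mathbb{C}_J$ is the bijection $\alpha+\imath\beta\mapsto\alpha+\beta J$. If $D=\overline D\subseteq\mathbb{R}_{\mathbb{C}}$ is open, a stem function is $F:D\to\mathbb{H}_{\mathbb{C}}$ with $F(\bar z)=\overline{F(z)}$; it is holomorphic if it is so with respect to multiplication by $\imath$. Families associated to $f$. Let $f$ be slice regular on a speared domain $\Omega$. For $J,K\in\mathbb{S}$ set $E^{J,K}=\phi_J^{-1}(\Omega_J^{\geqslant})\cap\phi_K^{-1}(\Omega_K^{\geqslant})$ and $D^{J,K}=E^{J,K}\cup\overline{E^{J,K}}$. For $J\ne K$ let $F^{J,K}:D^{J,K}\to\mathbb{H}_{\mathbb{C}}$ be the holomorphic stem function with \[F^{J,K}(\alpha+\imath\beta)=(J-K)^{-1}[Jf(\alpha+\beta J)-Kf(\alpha+\beta K)]+\imath(J-K)^{-1}[f(\alpha+\beta J)-f(\alpha+\beta K)]\] for $\alpha+\imath\beta\in E^{J,K}$, and $F^{J,K}(\bar z)=\overline{F^{J,K}(z)}$. Set $D^J=\phi_J^{-1}(\Omega_J^{\geqslant})\cup\overline{\phi_J^{-1}(\Omega_J^{\geqslant})}$. For each $z\in D^J$ the value $F^{J,K}(z)$ is defined and independent of $K$ for all $K\in\mathbb{S}\setminus\{J\}$ sufficiently close to $J$; $F^J(z)$ denotes this common value. This defines holomorphic stem functions $F^J:D^J\to\mathbb{H}_{\mathbb{C}}$,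 forming the holomorphic stem family associated to $f$. Spherical value and derivative. For $J_0\in\mathbb{S}$ there is a speared open $\Lambda\subseteq\Omega$ with $\mathrm{core}(\Omega)\cup\Omega_{J_0}^{\geqslant}\subseteq\Lambda$ such that $f(\alpha+\beta I)=(J-K)^{-1}[Jf(\alpha+\beta J)-Kf(\alpha+\beta K)]+I(J-K)^{-1}[f(\alpha+\beta J)-f(\alpha+\beta K)]$ whenever $J\ne K$, $\beta\ge0$ and $\alpha+\beta I,\alpha+\beta J,\alpha+\beta K\in\Lambda$. For $x_0=\alpha+\beta J_0\in\Omega$ with $\beta\ge0$, set $f_s^\circ(x_0)=(J-K)^{-1}[Jf(\alpha+\beta J)-Kf(\alpha+\beta K)]$ and, if $\beta>0$, $f'_s(x_0)=\beta^{-1}(J-K)^{-1}[f(\alpha+\beta J)-f(\alpha+\beta K)]$, for any $J\neq K$ with $\alpha+\beta J,\alpha+\beta K\in\Lambda$ (independent of choices). Equivalently, writing $F^{J_0}=F^{J_0}_1+\imath F^{J_0}_2$ with $\mathbb{H}$-valued $F^{J_0}_1,F^{J_0}_2$: $f_s^\circ(x_0)=F_1^{J_0}(\alpha+\beta\imath)$ and $f'_s(x_0)=\beta^{-1}F_2^{J_0}(\alpha+\beta\imath)$. Hinged points. Let $x_0=\alpha+\beta J_0$, $x_1=\alpha+\beta J_1$, $y_0=\alpha'+\beta'J_0$, $y_1=\alpha'+\beta'J_1$ be points of $\Omega$, with $\beta,\beta'\geq0$, $J_0,J_1\in\mathbb{S}$. We say $(x_1,y_1)$ shadows $(x_0,y_0)$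 in $\Omega$ if there is a path $\gamma:[0,1]\to E^{J_0,J_1}$ with $\gamma(0)=\alpha+\beta\imath$, $\gamma(1)=\alpha'+\beta'\imath$. We say $x_1$ is strongly hinged to $x_0$ in $\Omega$ if there is $y\in\Omega\cap\mathbb{R}$ such that $(x_1,y)$ shadows $(x_0,y)$. Let $t\ge1$ be an integer, $T=\{0,\dots,t\}$ and $\{x_s\}_{s=0}^t$ a finite sequence in $\Omega$. For $s,s'\in T$ with $|s-s'|=1$, there is a simple step at $s_0=\min\{s,s'\}$ if (1) $x_{s'}$ belongs to the connected component of $\mathbb{S}_{x_s}\cap\Omega$ that includes $x_s$; or (2) $x_{s'}$ is strongly hinged to $x_s$. If (1) and (2) are false but (3) there exist $s'',s'''\in T\setminus\{s,s'\}$ with $s''-s'''=s'-s$ such that $(x_{s''},x_{s'''})$ shadows $(x_s,x_{s'})$, then, with $\underline{s}=\min\{s,s',s'',s'''\}$ and $\overline{s}=\max\{s,s',s'',s'''\}-1$, there is a double step at $(\underline{s},\overline{s})$. The sequence is a chain of length $t$ connecting $x_0$ and $x_t$ if, after erasing from $T$ the index $t$ and all indices where a simple step happens, there remains an even number $2\ell$ of indices, which can be listed as $\underline{s}_1,\overline{s}_1,\ldots,\underline{s}_\ell,\overline{s}_\ell$ so that for all $m,n\in\{1,\dots,\ell\}$: a double step happens at $(\underline{s}_m,\overline{s}_m)$ (whence $\underline{s}_m<\overline{s}_m$); $\underline{s}_1<\ldots<\underline{s}_\ell$; and if $m<n$ then either $\overline{s}_m<\underline{s}_n$ or $\overline{s}_m>\overline{s}_n$.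 For $x,x'\in\Omega$, $x'$ is hinged to $x$ in $\Omega$, written $x\sim x'$, if there is a chain connecting $x$ and $x'$. *)

theory Defs
  imports "HOL-Analysis.Analysis"
begin

section \<open>Quaternions\<close>

datatype quat = Quat (qRe: real) (qI: real) (qJ: real) (qK: real)

lemma quat_eq_iff: "x = y \<longleftrightarrow> qRe x = qRe y \<and> qI x = qI y \<and> qJ x = qJ y \<and> qK x = qK y"
  by (cases x; cases y) simp

instantiation quat :: real_vector
begin
definition "0 = Quat 0 0 0 0"
definition "x + y = Quat (qRe x + qRe y) (qI x + qI y) (qJ x + qJ y) (qK x + qK y)"
definition "x - y = Quat (qRe x - qRe y) (qI x - qI y) (qJ x - qJ y) (qK x - qK y)"
definition "- x = Quat (- qRe x) (- qI x) (- qJ x) (- qK x)"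
definition "r *\<^sub>R x = Quat (r * qRe x) (r * qI x) (r * qJ x) (r * qK x)"
instance
  by standard
     (simp_all add: quat_eq_iff zero_quat_def plus_quat_def minus_quat_def uminus_quat_def
        scaleR_quat_def algebra_simps)
end

lemma quat_linear_sel [simp]:
  "qRe 0 = 0" "qI 0 = 0" "qJ 0 = 0" "qK 0 = 0"
  "qRe (x + y) = qRe x + qRe y" "qI (x + y) = qI x + qI y"
  "qJ (x + y) = qJ x + qJ y" "qK (x + y) = qK x + qK y"
  "qRe (x - y) = qRe x - qRe y" "qI (x - y) = qI x - qI y"
  "qJ (x - y) = qJ x - qJ y" "qK (x - y) = qK x - qK y"
  "qRe (- x) = - qRe x" "qI (- x) = - qI x" "qJ (- x) = - qJ x" "qK (- x) = - qK x"
  "qRe (r *\<^sub>R x) = r * qRe x" "qI (r *\<^sub>R x) = r * qI x"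
  "qJ (r *\<^sub>R x) = r * qJ x" "qK (r *\<^sub>R x) = r * qK x"
  by (simp_all add: zero_quat_def plus_quat_def minus_quat_def uminus_quat_def scaleR_quat_def)

instantiation quat :: real_algebra_1
begin
definition "1 = Quat 1 0 0 0"
definition "x * y = Quat
  (qRe x * qRe y - qI x * qI y - qJ x * qJ y - qK x * qK y)
  (qRe x * qI y + qI x * qRe y + qJ x * qK y - qK x * qJ y)
  (qRe x * qJ y - qI x * qK y + qJ x * qRe y + qK x * qI y)
  (qRe x * qK y + qI x * qJ y - qJ x * qI y + qK x * qRe y)"
instance
  by standard (simp_all add: quat_eq_iff one_quat_def times_quat_def algebra_simps)
end

lemma quat_ring_sel [simp]:
  "qRe 1 = 1" "qI 1 = 0" "qJ 1 = 0" "qK 1 = 0"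
  "qRe (x * y) = qRe x * qRe y - qI x * qI y - qJ x * qJ y - qK x * qK y"
  "qI (x * y) = qRe x * qI y + qI x * qRe y + qJ x * qK y - qK x * qJ y"
  "qJ (x * y) = qRe x * qJ y - qI x * qK y + qJ x * qRe y + qK x * qI y"
  "qK (x * y) = qRe x * qK y + qI x * qJ y - qJ x * qI y + qK x * qRe y"
  by (simp_all add: one_quat_def times_quat_def)

lemma quat_of_real_sel [simp]:
  "qRe (of_real r) = r" "qI (of_real r) = 0" "qJ (of_real r) = 0" "qK (of_real r) = 0"
  by (simp_all add: of_real_def)

instantiation quat :: real_inner
begin
definition "inner x y = qRe x * qRe y + qI x * qI y + qJ x * qJ y + qK x * qK y"
definition "norm (x::quat) = sqrt (inner x x)"
definition "dist (x::quat) y = norm (x - y)"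
definition "sgn (x::quat) = x /\<^sub>R norm x"
definition "(uniformity :: (quat \<times> quat) filter) = (INF e\<in>{0 <..}. principal {(x, y). dist x y < e})"
definition "open (U::quat set) \<longleftrightarrow> (\<forall>x\<in>U. eventually (\<lambda>(x', y). x' = x \<longrightarrow> y \<in> U) uniformity)"
instance
proof
  fix x y z :: quat and r :: real and U :: "quat set"
  show "dist x y = norm (x - y)" by (rule dist_quat_def)
  show "sgn x = x /\<^sub>R norm x" by (rule sgn_quat_def)
  show "(uniformity :: (quat \<times> quat) filter) = (INF e\<in>{0 <..}. principal {(x, y). dist x y < e})"
    by (rule uniformity_quat_def)
  show "open U \<longleftrightarrow> (\<forall>x\<in>U. eventually (\<lambda>(x', y). x' = x \<longrightarrow> y \<in> U) uniformity)"
    by (rule open_quat_def)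
  show "inner x y = inner y x" "inner (x + y) z = inner x z + inner y z"
    "inner (r *\<^sub>R x) y = r * inner x y"
    by (simp_all add: inner_quat_def algebra_simps)
  show "norm x = sqrt (inner x x)" by (rule norm_quat_def)
  show "0 \<le> inner x x" by (simp add: inner_quat_def)
  show "inner x x = 0 \<longleftrightarrow> x = 0"
    by (simp add: inner_quat_def quat_eq_iff add_nonneg_eq_0_iff)
qed
end

instantiation quat :: real_normed_div_algebra
begin
definition "inverse x = (1 / inner x x) *\<^sub>R Quat (qRe x) (- qI x) (- qJ x) (- qK x)"
definition "x div (y::quat) = x * inverse y"
instance
proof
  fix x y :: quat
  let ?c = "Quat (qRe x) (- qI x) (- qJ x) (- qK x)"
  have c: "?c * x = inner x x *\<^sub>R 1" "x * ?c = inner x x *\<^sub>R 1"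
    by (simp_all add: quat_eq_iff inner_quat_def)
  show "inverse x * x = 1" "x * inverse x = 1" if "x \<noteq> 0"
    using that by (simp_all add: inverse_quat_def c)
  show "x div y = x * inverse y" by (rule divide_quat_def)
  show "inverse (0::quat) = 0" by (simp add: inverse_quat_def)
  have "inner (x * y) (x * y) = inner x x * inner y y"
    unfolding inner_quat_def quat_ring_sel by (simp only: algebra_simps)
  then show "norm (x * y) = norm x * norm y"
    by (simp add: norm_quat_def real_sqrt_mult)
qed
end

instantiation quat :: euclidean_space
begin
definition "Basis = {Quat 1 0 0 0, Quat 0 1 0 0, Quat 0 0 1 0, Quat 0 0 0 1}"
instance
proof
  fix u v x :: quat
  show "(Basis :: quat set) \<noteq> {}" "finite (Basis :: quat set)"
    by (simp_all add: Basis_quat_def)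
  show "inner u v = (if u = v then 1 else 0)" if "u \<in> Basis" "v \<in> Basis"
    using that unfolding Basis_quat_def by (elim insertE emptyE) (simp_all add: inner_quat_def)
  show "(\<forall>u\<in>Basis. inner x u = 0) \<longleftrightarrow> x = 0"
    by (simp add: Basis_quat_def inner_quat_def quat_eq_iff[of x 0])
qed
end


section \<open>Slices and slice regular functions\<close>

definition imag_units :: "quat set" where
  "imag_units = {w. w\<^sup>2 = - 1}"

text \<open>
  The algebra \<open>\<real>\<^sub>\<complex> = \<real> + \<i>\<real>\<close> is represented by the type \<^typ>\<open>complex\<close>;
  \<open>slice_emb J\<close> is the map \<open>\<alpha> + \<i>\<beta> \<mapsto> \<alpha> + \<beta>J\<close>.
\<close>

definition slice_emb :: "quat \<Rightarrow> complex \<Rightarrow> quat" where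
  "slice_emb J z = of_real (Re z) + of_real (Im z) * J"

definition half_slice :: "quat \<Rightarrow> quat set" where
  "half_slice I = slice_emb I ` {z. Im z \<ge> 0}"

definition two_sphere :: "quat \<Rightarrow> quat set" where
  "two_sphere x = {y. \<exists>z. \<exists>I\<in>imag_units. \<exists>J\<in>imag_units. x = slice_emb I z \<and> y = slice_emb J z}"

definition is_domain :: "quat set \<Rightarrow> bool" where
  "is_domain \<Omega> \<longleftrightarrow> \<Omega> \<noteq> {} \<and> open \<Omega> \<and> connected \<Omega>"

definition speared :: "quat set \<Rightarrow> bool" where
  "speared U \<longleftrightarrow> open U \<and>
     (\<forall>I\<in>imag_units. \<forall>C\<in>components (U \<inter> half_slice I). C \<inter> \<real> \<noteq> {})"

definition speared_domain :: "quat set \<Rightarrow> bool" where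
  "speared_domain \<Omega> \<longleftrightarrow> is_domain \<Omega> \<and> speared \<Omega>"

definition symmetric_set :: "quat set \<Rightarrow> bool" where
  "symmetric_set T \<longleftrightarrow> (\<forall>z. \<forall>I\<in>imag_units. slice_emb I z \<in> T \<longrightarrow>
     (\<forall>J\<in>imag_units. slice_emb J z \<in> T))"

definition core :: "quat set \<Rightarrow> quat set" where
  "core U = \<Union>{V. V \<subseteq> U \<and> symmetric_set V \<and> speared V}"

lemma core_largest:
  "core U \<subseteq> U" "symmetric_set (core U)" "speared (core U)"
  "V \<subseteq> U \<Longrightarrow> symmetric_set V \<Longrightarrow> speared V \<Longrightarrow> V \<subseteq> core U"
proof -
  show "core U \<subseteq> U" "V \<subseteq> U \<Longrightarrow> symmetric_set V \<Longrightarrow> speared V \<Longrightarrow> V \<subseteq> core U"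
    by (auto simp: core_def)
  show "symmetric_set (core U)"
    unfolding core_def symmetric_set_def by blast
  show "speared (core U)"
    unfolding speared_def
  proof (intro conjI ballI)
    show "open (core U)" by (auto simp: core_def speared_def)
    fix I C assume I: "I \<in> imag_units" and C: "C \<in> components (core U \<inter> half_slice I)"
    obtain x where x: "x \<in> core U \<inter> half_slice I"
      and Cx: "C = connected_component_set (core U \<inter> half_slice I) x"
      using C by (auto simp: components_def)
    obtain W where W: "W \<subseteq> U" "symmetric_set W" "speared W" "x \<in> W"
      using x by (auto simp: core_def)
    let ?D = "connected_component_set (W \<inter> half_slice I) x"
    have "?D \<in> components (W \<inter> half_slice I)"
      using W x by (auto simp: components_def)
    then have "?D \<inter> \<real> \<noteq> {}" using W I by (auto simp: speared_def)
    moreover have "W \<subseteq> core U" using W by (auto simp: core_def)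
    then have "?D \<subseteq> C" unfolding Cx by (intro connected_component_mono) auto
    ultimately show "C \<inter> \<real> \<noteq> {}" by auto
  qed
qed

text \<open>
  The \<open>C\<^sup>1\<close> condition on the restriction to \<open>\<Omega>\<^sub>I\<close> is expressed in the coordinates
  \<open>\<alpha> + \<i>\<beta>\<close>, by a continuous Frechet derivative \<open>D\<close>; then \<open>D z 1\<close> and \<open>D z \<i>\<close> are the
  partial derivatives with respect to \<open>\<alpha>\<close> and \<open>\<beta>\<close>.
\<close>

definition slice_regular :: "(quat \<Rightarrow> quat) \<Rightarrow> quat set \<Rightarrow> bool" where
  "slice_regular f \<Omega> \<longleftrightarrow> (\<forall>I\<in>imag_units.
     \<exists>D :: complex \<Rightarrow> complex \<Rightarrow>\<^sub>L quat.
       continuous_on (slice_emb I -` \<Omega>) D \<and>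
       (\<forall>z\<in>slice_emb I -` \<Omega>.
          ((\<lambda>w. f (slice_emb I w)) has_derivative blinfun_apply (D z)) (at z) \<and>
          blinfun_apply (D z) 1 + I * blinfun_apply (D z) \<i> = 0))"


section \<open>The stem family of a slice regular function\<close>

text \<open>The pair \<open>(x, y)\<close> stands for the element \<open>x + \<i>y\<close> of \<open>\<real>\<^sub>\<complex> \<otimes> \<H>\<close>, the complexified quaternions.\<close>

type_synonym quat_cx = "quat \<times> quat"

definition qc_cnj :: "quat_cx \<Rightarrow> quat_cx" where
  "qc_cnj w = (fst w, - snd w)"

definition stem_E :: "quat set \<Rightarrow> quat \<Rightarrow> quat \<Rightarrow> complex set" where
  "stem_E \<Omega> J K = slice_emb J -` (\<Omega> \<inter> half_slice J) \<inter> slice_emb K -` (\<Omega> \<inter> half_slice K)"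

definition stem_D :: "quat set \<Rightarrow> quat \<Rightarrow> quat \<Rightarrow> complex set" where
  "stem_D \<Omega> J K = stem_E \<Omega> J K \<union> cnj ` stem_E \<Omega> J K"

definition rep_fst :: "(quat \<Rightarrow> quat) \<Rightarrow> quat \<Rightarrow> quat \<Rightarrow> complex \<Rightarrow> quat" where
  "rep_fst f J K z = inverse (J - K) * (J * f (slice_emb J z) - K * f (slice_emb K z))"

definition rep_snd :: "(quat \<Rightarrow> quat) \<Rightarrow> quat \<Rightarrow> quat \<Rightarrow> complex \<Rightarrow> quat" where
  "rep_snd f J K z = inverse (J - K) * (f (slice_emb J z) - f (slice_emb K z))"

definition stem_JK :: "(quat \<Rightarrow> quat) \<Rightarrow> quat \<Rightarrow> quat \<Rightarrow> complex \<Rightarrow> quat_cx" where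
  "stem_JK f J K z =
     (if Im z \<ge> 0 then (rep_fst f J K z, rep_snd f J K z)
      else qc_cnj (rep_fst f J K (cnj z), rep_snd f J K (cnj z)))"

text \<open>
  The value of \<open>F\<^sup>J\<close> at \<open>z\<close> is the common value of all \<open>F\<^sup>J\<^sup>K z\<close> for \<open>K \<noteq> J\<close> in the sphere of
  imaginary units sufficiently close to \<open>J\<close>. It is unique if it exists, as \<open>J\<close> is not isolated.
\<close>

definition stem_J :: "quat set \<Rightarrow> (quat \<Rightarrow> quat) \<Rightarrow> quat \<Rightarrow> complex \<Rightarrow> quat_cx" where
  "stem_J \<Omega> f J z = (THE w. \<forall>\<^sub>F K in at J within imag_units.
     z \<in> stem_D \<Omega> J K \<and> stem_JK f J K z = w)"


section \<open>Spherical value and spherical derivative\<close>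

definition rep_domain :: "quat set \<Rightarrow> (quat \<Rightarrow> quat) \<Rightarrow> quat \<Rightarrow> quat set \<Rightarrow> bool" where
  "rep_domain \<Omega> f J\<^sub>0 \<Lambda> \<longleftrightarrow> speared \<Lambda> \<and> \<Lambda> \<subseteq> \<Omega> \<and> core \<Omega> \<union> (\<Omega> \<inter> half_slice J\<^sub>0) \<subseteq> \<Lambda> \<and>
     (\<forall>z. \<forall>I\<in>imag_units. \<forall>J\<in>imag_units. \<forall>K\<in>imag_units.
        J \<noteq> K \<and> Im z \<ge> 0 \<and> slice_emb I z \<in> \<Lambda> \<and> slice_emb J z \<in> \<Lambda> \<and> slice_emb K z \<in> \<Lambda> \<longrightarrow>
        f (slice_emb I z) = rep_fst f J K z + I * rep_snd f J K z)"

text \<open>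
  The following values do not depend on \<open>\<Lambda>, J, K\<close>, nor, at a real point, on \<open>J\<^sub>0\<close>:
  there \<open>rep_fst\<close> equals \<open>f x\<^sub>0\<close>.
\<close>

definition spherical_value :: "quat set \<Rightarrow> (quat \<Rightarrow> quat) \<Rightarrow> quat \<Rightarrow> quat" where
  "spherical_value \<Omega> f x\<^sub>0 = (THE v. \<exists>z J\<^sub>0 \<Lambda> J K.
     J\<^sub>0 \<in> imag_units \<and> Im z \<ge> 0 \<and> x\<^sub>0 = slice_emb J\<^sub>0 z \<and> x\<^sub>0 \<in> \<Omega> \<and> rep_domain \<Omega> f J\<^sub>0 \<Lambda> \<and>
     J \<in> imag_units \<and> K \<in> imag_units \<and> J \<noteq> K \<and> slice_emb J z \<in> \<Lambda> \<and> slice_emb K z \<in> \<Lambda> \<and>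
     v = rep_fst f J K z)"

definition spherical_deriv :: "quat set \<Rightarrow> (quat \<Rightarrow> quat) \<Rightarrow> quat \<Rightarrow> quat" where
  "spherical_deriv \<Omega> f x\<^sub>0 = (THE v. \<exists>z J\<^sub>0 \<Lambda> J K.
     J\<^sub>0 \<in> imag_units \<and> Im z > 0 \<and> x\<^sub>0 = slice_emb J\<^sub>0 z \<and> x\<^sub>0 \<in> \<Omega> \<and> rep_domain \<Omega> f J\<^sub>0 \<Lambda> \<and>
     J \<in> imag_units \<and> K \<in> imag_units \<and> J \<noteq> K \<and> slice_emb J z \<in> \<Lambda> \<and> slice_emb K z \<in> \<Lambda> \<and>
     v = inverse (of_real (Im z)) * rep_snd f J K z)"


section \<open>Hinged points\<close>

text \<open>
  \<open>shadows \<Omega> x\<^sub>1 y\<^sub>1 x\<^sub>0 y\<^sub>0\<close>: the pair \<open>(x\<^sub>1, y\<^sub>1)\<close> shadows \<open>(x\<^sub>0, y\<^sub>0)\<close>. Real points can be written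
  as \<open>\<alpha> + 0J\<close> with any \<open>J\<close>; it is required that some choice of \<open>J\<^sub>0, J\<^sub>1\<close> works for all four points.
\<close>

definition shadows :: "quat set \<Rightarrow> quat \<Rightarrow> quat \<Rightarrow> quat \<Rightarrow> quat \<Rightarrow> bool" where
  "shadows \<Omega> x\<^sub>1 y\<^sub>1 x\<^sub>0 y\<^sub>0 \<longleftrightarrow> {x\<^sub>0, x\<^sub>1, y\<^sub>0, y\<^sub>1} \<subseteq> \<Omega> \<and>
     (\<exists>z z'. \<exists>J\<^sub>0\<in>imag_units. \<exists>J\<^sub>1\<in>imag_units. Im z \<ge> 0 \<and> Im z' \<ge> 0 \<and>
        x\<^sub>0 = slice_emb J\<^sub>0 z \<and> x\<^sub>1 = slice_emb J\<^sub>1 z \<and>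
        y\<^sub>0 = slice_emb J\<^sub>0 z' \<and> y\<^sub>1 = slice_emb J\<^sub>1 z' \<and>
        (\<exists>\<gamma>. path \<gamma> \<and> path_image \<gamma> \<subseteq> stem_E \<Omega> J\<^sub>0 J\<^sub>1 \<and> pathstart \<gamma> = z \<and> pathfinish \<gamma> = z'))"

definition strongly_hinged :: "quat set \<Rightarrow> quat \<Rightarrow> quat \<Rightarrow> bool" where
  "strongly_hinged \<Omega> x\<^sub>1 x\<^sub>0 \<longleftrightarrow> (\<exists>y\<in>\<Omega> \<inter> \<real>. shadows \<Omega> x\<^sub>1 y x\<^sub>0 y)"

text \<open>In the next definitions \<open>x :: nat \<Rightarrow> quat\<close> represents the sequence \<open>x\<^sub>0, \<dots>, x\<^sub>t\<close>.\<close>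

definition simple_pair :: "quat set \<Rightarrow> (nat \<Rightarrow> quat) \<Rightarrow> nat \<Rightarrow> nat \<Rightarrow> bool" where
  "simple_pair \<Omega> x s s' \<longleftrightarrow>
     x s' \<in> connected_component_set (two_sphere (x s) \<inter> \<Omega>) (x s) \<or>
     strongly_hinged \<Omega> (x s') (x s)"

definition simple_step :: "quat set \<Rightarrow> (nat \<Rightarrow> quat) \<Rightarrow> nat \<Rightarrow> nat \<Rightarrow> bool" where
  "simple_step \<Omega> x t i \<longleftrightarrow> (\<exists>s\<in>{0..t}. \<exists>s'\<in>{0..t}.
     \<bar>int s - int s'\<bar> = 1 \<and> i = min s s' \<and> simple_pair \<Omega> x s s')"

definition double_step :: "quat set \<Rightarrow> (nat \<Rightarrow> quat) \<Rightarrow> nat \<Rightarrow> nat \<Rightarrow> nat \<Rightarrow> bool" where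
  "double_step \<Omega> x t i j \<longleftrightarrow> (\<exists>s\<in>{0..t}. \<exists>s'\<in>{0..t}.
     \<bar>int s - int s'\<bar> = 1 \<and> \<not> simple_pair \<Omega> x s s' \<and>
     (\<exists>s''\<in>{0..t} - {s, s'}. \<exists>s'''\<in>{0..t} - {s, s'}.
        int s'' - int s''' = int s' - int s \<and>
        shadows \<Omega> (x s'') (x s''') (x s) (x s') \<and>
        i = Min {s, s', s'', s'''} \<and> j = Max {s, s', s'', s'''} - 1))"

definition hinge_chain :: "quat set \<Rightarrow> (nat \<Rightarrow> quat) \<Rightarrow> nat \<Rightarrow> bool" where
  "hinge_chain \<Omega> x t \<longleftrightarrow> t \<ge> 1 \<and> x ` {0..t} \<subseteq> \<Omega> \<and>
     (\<exists>l a b.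
        {0..t} - {t} - {s. simple_step \<Omega> x t s} = a ` {1..l} \<union> b ` {1..l} \<and>
        card ({0..t} - {t} - {s. simple_step \<Omega> x t s}) = 2 * l \<and>
        (\<forall>m\<in>{1..l}. double_step \<Omega> x t (a m) (b m)) \<and>
        (\<forall>m\<in>{1..l}. \<forall>n\<in>{1..l}. m < n \<longrightarrow>
           a m < a n \<and> (b m < a n \<or> b m > b n)))"

definition hinged :: "quat set \<Rightarrow> quat \<Rightarrow> quat \<Rightarrow> bool" where
  "hinged \<Omega> p p' \<longleftrightarrow> (\<exists>x t. hinge_chain \<Omega> x t \<and> x 0 = p \<and> x t = p')"

end

theory Submission
  imports Defs "HOL-Complex_Analysis.Conformal_Mappings"
begin

text \<open>
  Spearedness joins every point of a half slice to a real point, so the identity principle for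
  stem functions shows that \<open>F\<^sup>J\<^sup>K\<close> does not depend on \<open>J, K\<close> as long as these vary
  in a small cap along such a connection (a tube). Hence the germ of \<open>F\<^sup>J\<close> at \<open>z\<close> is locally constant
  in \<open>J\<close>, does not depend on \<open>J\<close> at real points, and an equality of the germs of \<open>F\<^sup>J\<close> and
  \<open>F\<^sup>K\<close> propagates along paths in \<open>E\<^sup>J\<^sup>K\<close>. These three facts say that simple steps preserve the
  germ, and that a double step transports an equality of germs between the two inner points to
  the two outer points; since double steps are nested like parentheses, induction on balanced
  intervals of steps gives the equality at the ends of a chain. For the spherical value and
  derivative, \<open>\<Lambda>\<close> is the union of the core with the tubes around \<open>J\<^sub>0\<close>.
\<close>

section \<open>Imaginary units and slices\<close>

text \<open>Multiplicativity of the norm turns \<open>J * J = -1\<close> into norm 1. The imaginary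
  components of \<open>J * J\<close> are twice the real part times those of \<open>J\<close>, so a
  nonzero real part would make \<open>J\<close> real with square -1.\<close>

lemma imag_units_iff: "J \<in> imag_units \<longleftrightarrow> qRe J = 0 \<and> norm J = 1"
proof
  assume J: "J \<in> imag_units"
  then have eq: "J * J = -1" by (simp add: imag_units_def power2_eq_square)
  then have "norm J * norm J = 1" by (metis norm_minus_cancel norm_mult norm_one)
  then have n: "norm J = 1" by (metis norm_ge_zero abs_of_nonneg real_sqrt_abs2 real_sqrt_one)
  have "qRe J = 0"
  proof (rule ccontr)
    assume r: "qRe J \<noteq> 0"
    have "qRe J * qI J = 0" "qRe J * qJ J = 0" "qRe J * qK J = 0"
      using arg_cong[OF eq, of qI] arg_cong[OF eq, of qJ] arg_cong[OF eq, of qK]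
      by (simp_all add: mult.commute)
    then have "qI J = 0" "qJ J = 0" "qK J = 0" using r by simp_all
    then have "qRe J * qRe J = -1" using arg_cong[OF eq, of qRe] by simp
    then show False by (metis neg_0_le_iff_le not_one_le_zero zero_le_square)
  qed
  with n show "qRe J = 0 \<and> norm J = 1" by simp
next
  assume J: "qRe J = 0 \<and> norm J = 1"
  then have "inner J J = 1" by (simp add: norm_eq_1)
  then show "J \<in> imag_units" using J
    by (simp add: imag_units_def power2_eq_square quat_eq_iff inner_quat_def algebra_simps)
qed

lemma imag_units_sq: "J \<in> imag_units \<Longrightarrow> J * J = -1"
  by (simp add: imag_units_def power2_eq_square)

lemma imag_units_sq_mult: "J \<in> imag_units \<Longrightarrow> J * (J * x) = - x"
  by (metis imag_units_sq mult.assoc mult_minus1)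

lemma uminus_imag_units [simp]: "- J \<in> imag_units \<longleftrightarrow> J \<in> imag_units"
  by (simp add: imag_units_def)

lemma inner_imag_unit_one: "J \<in> imag_units \<Longrightarrow> inner J 1 = 0"
  by (simp add: imag_units_iff inner_quat_def)

lemma inner_imag_unit_self: "J \<in> imag_units \<Longrightarrow> inner J J = 1"
  by (simp add: imag_units_iff norm_eq_1)

lemma imag_unit_orthogonal:
  assumes "J \<in> imag_units"
  obtains L where "L \<in> imag_units" "inner J L = 0"
proof -
  have "\<exists>v. v \<noteq> 0 \<and> qRe v = 0 \<and> inner J v = 0"
  proof (cases "qI J = 0 \<and> qJ J = 0")
    case True
    then show ?thesis by (intro exI[of _ "Quat 0 1 0 0"]) (simp add: inner_quat_def quat_eq_iff)
  next
    case False
    \<comment> \<open>A quarter turn of the components along i and j; it is nonzero precisely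
      outside the case treated before.\<close>
    then show ?thesis
      by (intro exI[of _ "Quat 0 (qJ J) (- qI J) 0"]) (auto simp: inner_quat_def quat_eq_iff)
  qed
  then obtain v where v: "v \<noteq> 0" "qRe v = 0" "inner J v = 0" by blast
  show ?thesis
    by (rule that[of "(1 / norm v) *\<^sub>R v"]) (use v in \<open>simp_all add: imag_units_iff\<close>)
qed

text \<open>The great circle through \<open>J\<close> and an orthogonal unit \<open>L\<close> tends
  to \<open>J\<close> without meeting it at small positive parameters. This non-isolation makes the
  limit values in \<open>stem_J\<close> and \<open>stem_germ\<close> unique.\<close>

lemma at_imag_unit_not_bot:
  assumes J: "J \<in> imag_units"
  shows "at J within imag_units \<noteq> bot"
proof -
  obtain L where L: "L \<in> imag_units" "inner J L = 0" using imag_unit_orthogonal[OF J] .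
  define c where "c t = cos t *\<^sub>R J + sin t *\<^sub>R L" for t :: real
  have "inner (c t) (c t) = 1" for t
    using L J by (simp add: c_def inner_add_left inner_add_right inner_imag_unit_self
        inner_commute[of L J] flip: power2_eq_square)
  then have mem: "c t \<in> imag_units" for t
    using L J by (simp add: imag_units_iff norm_eq_1) (simp add: c_def imag_units_iff)
  have ne: "c t \<noteq> J" if "0 < t" "t < pi" for t
  proof
    assume "c t = J"
    then have "inner (c t) L = 0" using L by simp
    then have "sin t = 0" using L J by (simp add: c_def inner_add_left inner_imag_unit_self)
    then show False using sin_gt_zero[OF that] by simp
  qed
  have "(c \<longlongrightarrow> c 0) (at_right 0)"
    unfolding c_def by (intro tendsto_intros)
  then have "(c \<longlongrightarrow> J) (at_right 0)" by (simp add: c_def)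
  moreover have "\<forall>\<^sub>F t in at_right 0. c t \<in> imag_units - {J}"
    unfolding eventually_at_right_field
    using ne mem pi_gt_zero by (intro exI[of _ pi]) auto
  ultimately have "filterlim c (at J within imag_units) (at_right 0)"
    unfolding filterlim_at by (auto elim: eventually_mono)
  then have "(\<forall>\<^sub>F K in at J within imag_units. False) \<Longrightarrow> (\<forall>\<^sub>F t in at_right (0::real). False)"
    by (auto simp: filterlim_iff)
  then show ?thesis by (auto simp: eventually_False)
qed

lemma imag_unit_near:
  assumes "J \<in> imag_units" "e > 0"
  obtains K where "K \<in> imag_units" "K \<noteq> J" "K \<in> ball J e"
proof -
  have "\<forall>\<^sub>F K in at J within imag_units. K \<in> imag_units \<and> K \<noteq> J \<and> K \<in> ball J e"
    unfolding eventually_at using assms by (auto simp: dist_commute)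
  then show ?thesis
    using at_imag_unit_not_bot[OF assms(1)] that eventually_happens' by blast
qed

section \<open>Coordinates on slices\<close>

lemma slice_emb_alt: "slice_emb J z = Re z *\<^sub>R 1 + Im z *\<^sub>R J"
  by (simp add: slice_emb_def of_real_def)

lemma slice_emb_cnj: "slice_emb J (cnj z) = slice_emb (- J) z"
  by (simp add: slice_emb_alt)

lemma continuous_on_slice_emb [continuous_intros]:
  "continuous_on A g \<Longrightarrow> continuous_on A h \<Longrightarrow> continuous_on A (\<lambda>x. slice_emb (g x) (h x))"
  unfolding slice_emb_alt by (intro continuous_intros)

lemma slice_emb_real: "Im z = 0 \<Longrightarrow> slice_emb J z = of_real (Re z)"
  by (simp add: slice_emb_def)

lemma qRe_slice_emb: "J \<in> imag_units \<Longrightarrow> qRe (slice_emb J z) = Re z"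
  by (simp add: slice_emb_alt imag_units_iff)

lemma inner_slice_emb: "J \<in> imag_units \<Longrightarrow> inner (slice_emb J z) J = Im z"
  by (simp add: slice_emb_alt inner_add_left inner_imag_unit_self inner_commute[of 1 J]
      inner_imag_unit_one)

text \<open>The real part and the norm of the vector part fix the point of the closed upper half
  plane; the unit is lost exactly on the real axis, hence the disjunction.\<close>

lemma slice_emb_unique:
  assumes "J \<in> imag_units" "K \<in> imag_units" "Im z \<ge> 0" "Im w \<ge> 0"
    and eq: "slice_emb J z = slice_emb K w"
  shows "z = w" "Im z = 0 \<or> J = K"
proof -
  have re: "Re z = Re w" using arg_cong[OF eq, of qRe] assms(1,2) by (simp add: qRe_slice_emb)
  then have v: "Im z *\<^sub>R J = Im w *\<^sub>R K" using eq by (simp add: slice_emb_alt)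
  then have "norm (Im z *\<^sub>R J) = norm (Im w *\<^sub>R K)" by simp
  then have "Im z = Im w" using assms by (simp add: imag_units_iff)
  with re v show "z = w" "Im z = 0 \<or> J = K" by (auto simp: complex_eq_iff)
qed

lemma dist_slice_emb:
  "dist (slice_emb J z) (slice_emb K z) = \<bar>Im z\<bar> * dist J K"
  by (simp add: slice_emb_alt dist_norm flip: scaleR_diff_right)

text \<open>Since 1 and \<open>J\<close> are orthonormal, slice embeddings are isometric. A ball
  about a real point therefore has the same trace in the coordinates of every slice.\<close>

lemma dist_slice_emb_real:
  assumes "J \<in> imag_units"
  shows "dist (slice_emb J z) (of_real r) = dist z (of_real r)"
proof -
  have "norm ((Re z - r) *\<^sub>R 1 + Im z *\<^sub>R J) ^ 2 = (Re z - r)\<^sup>2 + (Im z)\<^sup>2"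
    unfolding power2_norm_eq_inner using assms
    by (simp add: inner_add_left inner_add_right inner_imag_unit_self inner_commute[of 1 J]
      inner_imag_unit_one power2_eq_square inner_quat_def[of 1 1])
  then have "norm ((Re z - r) *\<^sub>R 1 + Im z *\<^sub>R J) = sqrt ((Re z - r)\<^sup>2 + (Im z)\<^sup>2)"
    by (metis norm_ge_zero real_sqrt_abs abs_of_nonneg)
  then show ?thesis
    by (simp add: dist_norm cmod_def slice_emb_alt of_real_def scaleR_diff_left algebra_simps)
qed

lemma slice_emb_in_half_slice: "Im z \<ge> 0 \<Longrightarrow> slice_emb J z \<in> half_slice J"
  by (auto simp: half_slice_def)

text \<open>Conjugation is traded for a sign change of the unit, simultaneously for all
  \<open>L\<close>. This normalises the arbitrary representations allowed in
  \<open>two_sphere\<close>.\<close>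

lemma slice_emb_nonneg_repr:
  assumes "J \<in> imag_units"
  obtains K w where "K \<in> imag_units" "Im w \<ge> 0" "slice_emb J z = slice_emb K w"
    "\<And>L. L \<in> imag_units \<Longrightarrow> \<exists>M\<in>imag_units. slice_emb L z = slice_emb M w"
proof (cases "Im z \<ge> 0")
  case True
  then show ?thesis using that[of J z] assms by blast
next
  case False
  have e: "slice_emb L z = slice_emb (- L) (cnj z)" for L by (simp add: slice_emb_cnj)
  show ?thesis
    by (rule that[of "- J" "cnj z"]) (use False assms e in \<open>auto intro!: bexI[of _ "- _"]\<close>)
qed

lemma real_quat_iff: "q \<in> \<real> \<longleftrightarrow> q = of_real (qRe q)"
  by (metis Reals_cases Reals_of_real quat_of_real_sel(1))

lemma slice_emb_in_Reals_iff:
  assumes "J \<in> imag_units"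
  shows "slice_emb J z \<in> \<real> \<longleftrightarrow> Im z = 0"
proof -
  have "J \<noteq> 0" using assms by (auto simp: imag_units_iff)
  then show ?thesis
    unfolding real_quat_iff qRe_slice_emb[OF assms] by (simp add: slice_emb_def)
qed

lemma connected_slice_preimage:
  assumes J: "J \<in> imag_units" and "connected C" "C \<subseteq> half_slice J"
  obtains C' where "connected C'" "C' \<subseteq> {z. Im z \<ge> 0}" "slice_emb J ` C' = C"
proof -
  \<comment> \<open>Orthogonal coordinates along 1 and \<open>J\<close>: a continuous left inverse
    of \<open>slice_emb J\<close>, which carries connected sets back to the plane.\<close>
  define p where "p q = Complex (qRe q) (inner q J)" for q
  have p: "p (slice_emb J z) = z" for z
    by (simp add: p_def qRe_slice_emb inner_slice_emb J)
  have "qRe q = inner q 1" for q by (simp add: inner_quat_def)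
  then have "p = (\<lambda>q. of_real (inner q 1) + \<i> * of_real (inner q J))"
    by (auto simp: p_def complex_eq_iff)
  then have "continuous_on UNIV p" by (simp only:) (intro continuous_intros)
  then have "connected (p ` C)"
    using assms by (meson connected_continuous_image continuous_on_subset subset_UNIV)
  moreover have "p ` C \<subseteq> {z. Im z \<ge> 0}" using assms p by (auto simp: half_slice_def)
  moreover have "slice_emb J ` (p ` C) = C"
  proof -
    have "slice_emb J (p q) = q" if "q \<in> C" for q
      using that assms(3) p by (auto simp: half_slice_def)
    then show ?thesis by (simp add: image_image cong: image_cong)
  qed
  ultimately show ?thesis using that by blast
qed

section \<open>Stem functions and the representation formula\<close>

text \<open>The prescribed linear map is multiplication of \<open>h\<close> by \<open>a + ib\<close>
  in the complexified quaternions, so this is holomorphy with respect to the central imaginary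
  unit.\<close>

definition stem_holo :: "(complex \<Rightarrow> quat_cx) \<Rightarrow> complex set \<Rightarrow> bool" where
  "stem_holo F U \<longleftrightarrow> (\<forall>w\<in>U. \<exists>a b. (F has_derivative
     (\<lambda>h. (Re h *\<^sub>R a - Im h *\<^sub>R b, Re h *\<^sub>R b + Im h *\<^sub>R a))) (at w))"

lemma stem_holo_subset: "stem_holo F U \<Longrightarrow> V \<subseteq> U \<Longrightarrow> stem_holo F V"
  by (auto simp: stem_holo_def)

text \<open>Pairing both components with a fixed vector \<open>v\<close> turns the Cauchy--Riemann equations of a
  stem function into those of a complex function.\<close>

lemma stem_holo_inner:
  assumes "stem_holo F U" "open U"
  shows "(\<lambda>w. Complex (inner (fst (F w)) v) (inner (snd (F w)) v)) holomorphic_on U"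
  unfolding holomorphic_on_open[OF assms(2)]
proof
  fix w assume "w \<in> U"
  then obtain a b where F: "(F has_derivative
     (\<lambda>h. (Re h *\<^sub>R a - Im h *\<^sub>R b, Re h *\<^sub>R b + Im h *\<^sub>R a))) (at w)"
    using assms by (auto simp: stem_holo_def)
  have "((\<lambda>w. of_real (inner (fst (F w)) v) + \<i> * of_real (inner (snd (F w)) v)) has_derivative
      (\<lambda>h. of_real (inner (Re h *\<^sub>R a - Im h *\<^sub>R b) v) +
        \<i> * of_real (inner (Re h *\<^sub>R b + Im h *\<^sub>R a) v))) (at w)"
    by (intro has_derivative_add has_derivative_of_real has_derivative_inner_left
        has_derivative_mult_right has_derivative_fst[OF F, simplified]
        has_derivative_snd[OF F, simplified])
  moreover have "(\<lambda>h. of_real (inner (Re h *\<^sub>R a - Im h *\<^sub>R b) v) +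
        \<i> * of_real (inner (Re h *\<^sub>R b + Im h *\<^sub>R a) v)) = (*) (Complex (inner a v) (inner b v))"
    by (auto simp: fun_eq_iff complex_eq_iff inner_add_left inner_diff_left algebra_simps)
  moreover have "(\<lambda>w. of_real (inner (fst (F w)) v) + \<i> * of_real (inner (snd (F w)) v)) =
      (\<lambda>w. Complex (inner (fst (F w)) v) (inner (snd (F w)) v))"
    by (auto simp: complex_eq_iff)
  ultimately show "\<exists>f'. ((\<lambda>w. Complex (inner (fst (F w)) v) (inner (snd (F w)) v))
      has_field_derivative f') (at w)"
    unfolding has_field_derivative_def by metis
qed

text \<open>The scalar identity theorem applies for each \<open>v\<close>, and nondegeneracy of the
  inner product recovers both components.\<close>

lemma stem_identity:
  assumes "stem_holo F U" "stem_holo F' U" "open U" "connected U"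
    and "\<xi> \<in> U" "S \<subseteq> U" "\<xi> islimpt S" "\<And>w. w \<in> S \<Longrightarrow> F w = F' w" "w \<in> U"
  shows "F w = F' w"
proof -
  let ?c = "\<lambda>F v w. Complex (inner (fst (F w)) v) (inner (snd (F w)) v)"
  have "?c F v w = ?c F' v w" for v
  proof -
    have "(\<lambda>w. ?c F v w - ?c F' v w) holomorphic_on U"
      using assms by (intro holomorphic_intros stem_holo_inner)
    then have "?c F v w - ?c F' v w = 0"
      by (rule analytic_continuation[where U=S and \<xi>=\<xi>]) (use assms in auto)
    then show ?thesis by simp
  qed
  then have "inner (fst (F w)) v = inner (fst (F' w)) v" "inner (snd (F w)) v = inner (snd (F' w)) v" for v
    by (simp_all add: complex_eq_iff)
  then show ?thesis
    by (metis prod_eq_iff vector_eq_rdot)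
qed

lemma stem_identity_open:
  assumes "stem_holo F U" "stem_holo F' U" "open U" "connected U"
    and "\<xi> \<in> U" "\<forall>\<^sub>F w in nhds \<xi>. F w = F' w" "w \<in> U"
  shows "F w = F' w"
proof -
  obtain S where S: "open S" "\<xi> \<in> S" "\<And>w. w \<in> S \<Longrightarrow> F w = F' w"
    using assms(6) by (auto simp: eventually_nhds)
  have "\<xi> islimpt (S \<inter> U)"
    using S assms by (intro interior_limit_point) (simp add: interior_open open_Int)
  then show ?thesis
    by (rule stem_identity[OF assms(1-5) Int_lower2]) (use S assms in auto)
qed

text \<open>Agrees with \<open>stem_JK\<close> on the closed upper half plane; without the
  conjugation below it, the formula is holomorphic across the real axis.\<close>

definition rep_pair :: "(quat \<Rightarrow> quat) \<Rightarrow> quat \<Rightarrow> quat \<Rightarrow> complex \<Rightarrow> quat_cx" where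
  "rep_pair f J K z = (rep_fst f J K z, rep_snd f J K z)"

text \<open>The two coefficients come from interpolating \<open>f\<close> affinely in the unit, with
  nodes \<open>J\<close> and \<open>K\<close>; this is the interpolation property at
  \<open>J\<close>.\<close>

lemma rep_pair_affine:
  assumes J: "J \<in> imag_units" and K: "K \<in> imag_units" and "J \<noteq> K"
  shows "f (slice_emb J z) = rep_fst f J K z + J * rep_snd f J K z"
proof -
  let ?q = "J - K" and ?a = "f (slice_emb J z)" and ?b = "f (slice_emb K z)"
  have q: "?q \<noteq> 0" using assms by simp
  \<comment> \<open>Moving \<open>J\<close> past the inverse of \<open>J - K\<close> replaces it by
    \<open>-K\<close>, because \<open>(J - K) * J\<close> and \<open>- K * (J - K)\<close> both
    equal \<open>- 1 - K * J\<close>.\<close>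
  have J1: "J * inverse ?q = - (inverse ?q * K)"
  proof -
    have "?q * J = - (K * ?q)" using J K by (simp add: algebra_simps imag_units_sq)
    then have "inverse ?q * (?q * J) * inverse ?q = inverse ?q * (- (K * ?q)) * inverse ?q" by simp
    then show ?thesis using q by (simp add: mult.assoc) (simp add: mult.assoc[symmetric])
  qed
  have "rep_fst f J K z + J * rep_snd f J K z = inverse ?q * (J * ?a - K * ?b - K * (?a - ?b))"
    unfolding rep_fst_def rep_snd_def mult.assoc[symmetric] J1 by (simp add: algebra_simps)
  also have "\<dots> = inverse ?q * ?q * ?a" by (simp add: algebra_simps)
  finally show "?a = rep_fst f J K z + J * rep_snd f J K z" using q by simp
qed

text \<open>Two distinct nodes determine the coefficients of an expression affine in the unit. This
  is how the pairs of different units are compared at a fixed \<open>z\<close>.\<close>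

lemma rep_pair_eqI:
  assumes J: "J \<in> imag_units" and K: "K \<in> imag_units" and "J \<noteq> K"
    and a: "f (slice_emb J z) = A + J * B" and b: "f (slice_emb K z) = A + K * B"
  shows "rep_pair f J K z = (A, B)"
proof -
  let ?q = "J - K"
  have q: "?q \<noteq> 0" using assms by simp
  have "J * (A + J * B) - K * (A + K * B) = ?q * A"
    using J K by (simp add: algebra_simps imag_units_sq_mult)
  moreover have "(A + J * B) - (A + K * B) = ?q * B" by (simp add: algebra_simps)
  ultimately show ?thesis
    using q by (simp add: rep_pair_def rep_fst_def rep_snd_def a b flip: mult.assoc)
qed

text \<open>On the real axis the choice of units disappears; this agreement is the starting point of
  every use of the identity principle between different pairs.\<close>

lemma rep_pair_real:
  assumes "Im z = 0" "J \<noteq> K"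
  shows "rep_pair f J K z = (f (of_real (Re z)), 0)"
proof -
  have "J - K \<noteq> 0" using assms by simp
  then show ?thesis using assms
    by (simp add: rep_pair_def rep_fst_def rep_snd_def slice_emb_real flip: left_diff_distrib mult.assoc)
qed

text \<open>In contrast to \<open>stem_E\<close>, the lower half plane is kept, so that for open
  \<open>\<Omega>\<close> and finite \<open>A\<close> real points are interior points.\<close>

definition slice_dom :: "quat set \<Rightarrow> quat set \<Rightarrow> complex set" where
  "slice_dom \<Omega> A = {w. \<forall>J\<in>A. slice_emb J w \<in> \<Omega>}"

lemma open_slice_dom: "open \<Omega> \<Longrightarrow> finite A \<Longrightarrow> open (slice_dom \<Omega> A)"
proof -
  assume "open \<Omega>" "finite A"
  have "slice_dom \<Omega> A = (\<Inter>J\<in>A. slice_emb J -` \<Omega>)" by (auto simp: slice_dom_def)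
  moreover have "open (slice_emb J -` \<Omega>)" for J
    using \<open>open \<Omega>\<close> by (rule open_vimage) (intro continuous_intros)
  ultimately show ?thesis using \<open>finite A\<close> by (simp add: open_INT)
qed

lemma slice_regular_derivative:
  assumes "slice_regular f \<Omega>" and J: "J \<in> imag_units" and "slice_emb J w \<in> \<Omega>"
  obtains d where "((\<lambda>w. f (slice_emb J w)) has_derivative
    (\<lambda>h. Re h *\<^sub>R d + Im h *\<^sub>R (J * d))) (at w)"
proof -
  obtain D :: "complex \<Rightarrow>\<^sub>L quat" where D: "((\<lambda>w. f (slice_emb J w)) has_derivative blinfun_apply D) (at w)"
    "blinfun_apply D 1 + J * blinfun_apply D \<i> = 0"
    using assms unfolding slice_regular_def by (metis vimageI)
  \<comment> \<open>Left multiplication by \<open>J\<close> solves the Cauchy-Riemann equation for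
    the derivative along the imaginary direction.\<close>
  have "J * (blinfun_apply D 1 + J * blinfun_apply D \<i>) = 0" using D(2) by simp
  then have i: "blinfun_apply D \<i> = J * blinfun_apply D 1"
    by (simp add: distrib_left imag_units_sq_mult J)
  have "blinfun_apply D h = Re h *\<^sub>R blinfun_apply D 1 + Im h *\<^sub>R (J * blinfun_apply D 1)" for h
  proof -
    have "h = Re h *\<^sub>R 1 + Im h *\<^sub>R \<i>" by (simp add: complex_eq_iff)
    then have "blinfun_apply D h = blinfun_apply D (Re h *\<^sub>R 1 + Im h *\<^sub>R \<i>)" by simp
    then show ?thesis by (simp only: blinfun.add_right blinfun.scaleR_right i)
  qed
  then show ?thesis using that[of "blinfun_apply D 1"] D(1)
    by (metis (no_types, lifting) ext)
qed

text \<open>If \<open>d\<close> and \<open>e\<close> are the real-direction derivatives on the two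
  slices, the derivative of the pair is multiplication by \<open>a + ib\<close>, where
  \<open>a\<close> and \<open>b\<close> are obtained from \<open>J * d - K * e\<close> and
  \<open>d - e\<close> by left multiplication with the inverse of \<open>J - K\<close>;
  \<open>J * J = -1\<close> and \<open>K * K = -1\<close> match the imaginary direction.\<close>

lemma stem_holo_rep_pair:
  assumes f: "slice_regular f \<Omega>" and J: "J \<in> imag_units" and K: "K \<in> imag_units"
  shows "stem_holo (rep_pair f J K) (slice_dom \<Omega> {J, K})"
  unfolding stem_holo_def
proof
  fix w assume "w \<in> slice_dom \<Omega> {J, K}"
  then have w: "slice_emb J w \<in> \<Omega>" "slice_emb K w \<in> \<Omega>" by (auto simp: slice_dom_def)
  obtain d where d: "((\<lambda>w. f (slice_emb J w)) has_derivative
    (\<lambda>h. Re h *\<^sub>R d + Im h *\<^sub>R (J * d))) (at w)"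
    using slice_regular_derivative[OF f J w(1)] .
  obtain e where e: "((\<lambda>w. f (slice_emb K w)) has_derivative
    (\<lambda>h. Re h *\<^sub>R e + Im h *\<^sub>R (K * e))) (at w)"
    using slice_regular_derivative[OF f K w(2)] .
  let ?q = "inverse (J - K)"
  have "(rep_pair f J K has_derivative (\<lambda>h.
      (?q * (J * (Re h *\<^sub>R d + Im h *\<^sub>R (J * d)) - K * (Re h *\<^sub>R e + Im h *\<^sub>R (K * e))),
       ?q * ((Re h *\<^sub>R d + Im h *\<^sub>R (J * d)) - (Re h *\<^sub>R e + Im h *\<^sub>R (K * e)))))) (at w)"
    unfolding rep_pair_def[abs_def] rep_fst_def rep_snd_def
    by (intro has_derivative_Pair has_derivative_mult_right has_derivative_diff d e)
  moreover have "(\<lambda>h.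
      (?q * (J * (Re h *\<^sub>R d + Im h *\<^sub>R (J * d)) - K * (Re h *\<^sub>R e + Im h *\<^sub>R (K * e))),
       ?q * ((Re h *\<^sub>R d + Im h *\<^sub>R (J * d)) - (Re h *\<^sub>R e + Im h *\<^sub>R (K * e))))) =
    (\<lambda>h. (Re h *\<^sub>R (?q * (J * d - K * e)) - Im h *\<^sub>R (?q * (d - e)),
          Re h *\<^sub>R (?q * (d - e)) + Im h *\<^sub>R (?q * (J * d - K * e))))"
    using J K by (auto simp: fun_eq_iff algebra_simps imag_units_sq_mult)
  ultimately show "\<exists>a b. (rep_pair f J K has_derivative
     (\<lambda>h. (Re h *\<^sub>R a - Im h *\<^sub>R b, Re h *\<^sub>R b + Im h *\<^sub>R a))) (at w)"
    by metis
qed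

lemma islimpt_real_line:
  assumes "open U" "complex_of_real r \<in> U"
  shows "complex_of_real r islimpt (U \<inter> \<real>)"
  unfolding islimpt_approachable
proof (intro allI impI)
  fix e :: real assume e: "e > 0"
  obtain d where d: "d > 0" "ball (complex_of_real r) d \<subseteq> U"
    using assms open_contains_ball by blast
  let ?x = "complex_of_real (r + min d e / 2)"
  have "dist ?x (complex_of_real r) = min d e / 2"
    using d e by (simp add: dist_norm)
  then show "\<exists>x'\<in>U \<inter> \<real>. x' \<noteq> complex_of_real r \<and> dist x' (complex_of_real r) < e"
    using d e by (intro bexI[of _ ?x]) (auto simp: subset_iff dist_commute)
qed

text \<open>Both pairs are holomorphic where all four slices stay in \<open>\<Omega>\<close>, and
  they agree at the real points there, which accumulate at \<open>r\<close>. The identity principle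
  carries the agreement along \<open>C\<close> to \<open>z\<close>.\<close>

lemma rep_pair_unique:
  assumes f: "slice_regular f \<Omega>" and "open \<Omega>"
    and units: "J \<in> imag_units" "K \<in> imag_units" "L \<in> imag_units" "M \<in> imag_units"
    and ne: "J \<noteq> K" "L \<noteq> M"
    and C: "connected C" "C \<subseteq> slice_dom \<Omega> {J, K, L, M}" "complex_of_real r \<in> C" "z \<in> C"
  shows "rep_pair f J K z = rep_pair f L M z"
proof -
  let ?W = "slice_dom \<Omega> {J, K, L, M}"
  \<comment> \<open>The set \<open>C\<close> need not be open; the component of the open set around
    it is a domain on which analytic continuation applies.\<close>
  let ?U = "connected_component_set ?W (complex_of_real r)"
  have W: "open ?W" using assms by (simp add: open_slice_dom)
  have U: "open ?U" "connected ?U" "?U \<subseteq> ?W"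
    using W by (simp_all add: open_connected_component connected_component_subset)
  have CU: "C \<subseteq> ?U" using C by (simp add: connected_component_maximal)
  have hJ: "stem_holo (rep_pair f J K) ?U"
    by (rule stem_holo_subset[OF stem_holo_rep_pair[OF f units(1,2)]])
      (use U(3) in \<open>auto simp: slice_dom_def\<close>)
  have hL: "stem_holo (rep_pair f L M) ?U"
    by (rule stem_holo_subset[OF stem_holo_rep_pair[OF f units(3,4)]])
      (use U(3) in \<open>auto simp: slice_dom_def\<close>)
  have r: "complex_of_real r \<in> ?U" using CU C by blast
  show ?thesis
  proof (rule stem_identity[OF hJ hL U(1,2) r _ islimpt_real_line[OF U(1) r]])
    show "rep_pair f J K w = rep_pair f L M w" if "w \<in> ?U \<inter> \<real>" for w
      using that ne by (simp add: rep_pair_real complex_is_Real_iff)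
  qed (use CU C in auto)
qed

section \<open>Tubes and germs of the stem family\<close>

text \<open>Connectedness is required of \<open>V\<close> and of its closed upper half separately: the former carries
  the identity principle, the latter makes the unions of tubes speared.\<close>

definition tube :: "quat set \<Rightarrow> quat \<Rightarrow> real \<Rightarrow> complex set \<Rightarrow> bool" where
  "tube \<Omega> J e V \<longleftrightarrow> e > 0 \<and> open V \<and> connected V \<and> connected (V \<inter> {z. Im z \<ge> 0}) \<and>
     (\<exists>r. complex_of_real r \<in> V) \<and> (\<forall>w\<in>V. \<forall>K\<in>imag_units \<inter> ball J e. slice_emb K w \<in> \<Omega>)"

lemma tubeD:
  assumes "tube \<Omega> J e V"
  shows "e > 0" "open V" "connected V" "connected (V \<inter> {z. Im z \<ge> 0})"
    "\<exists>r. complex_of_real r \<in> V"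
    "w \<in> V \<Longrightarrow> K \<in> imag_units \<Longrightarrow> K \<in> ball J e \<Longrightarrow> slice_emb K w \<in> \<Omega>"
  using assms by (auto simp: tube_def)

text \<open>Joint continuity in the unit and the point gives a product neighbourhood; one radius
  then serves for both factors.\<close>

lemma slice_emb_local:
  assumes "open \<Omega>" "slice_emb J p \<in> \<Omega>"
  obtains e where "e > 0" "\<And>w K. w \<in> ball p e \<Longrightarrow> K \<in> ball J e \<Longrightarrow> slice_emb K w \<in> \<Omega>"
proof -
  have "open ((\<lambda>x. slice_emb (fst x) (snd x)) -` \<Omega>)"
    using assms(1) by (rule open_vimage) (intro continuous_intros)
  moreover have "(J, p) \<in> (\<lambda>x. slice_emb (fst x) (snd x)) -` \<Omega>" using assms by simp
  ultimately obtain A B where "open A" "open B" "(J, p) \<in> A \<times> B"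
    and AB: "A \<times> B \<subseteq> (\<lambda>x. slice_emb (fst x) (snd x)) -` \<Omega>"
    by (rule open_prod_elim)
  then have "open A" "open B" "J \<in> A" "p \<in> B" by auto
  then obtain a b where "a > 0" "ball J a \<subseteq> A" "b > 0" "ball p b \<subseteq> B"
    using open_contains_ball by metis
  then show ?thesis
    using AB by (intro that[of "min a b"]) (auto simp: subset_iff)
qed

text \<open>The common point \<open>q\<close> lies in the closed upper half plane, so both unions,
  full and upper, remain connected. The cap shrinks to the smaller radius.\<close>

lemma tube_union_ball:
  assumes tube: "tube \<Omega> J d V" and e: "e > 0"
    and ball: "\<And>w K. w \<in> ball p e \<Longrightarrow> K \<in> ball J e \<Longrightarrow> slice_emb K w \<in> \<Omega>"
    and q: "q \<in> V" "q \<in> ball p e" "Im q \<ge> 0"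
  shows "tube \<Omega> J (min d e) (V \<union> ball p e)"
proof -
  let ?H = "{z. Im z \<ge> 0}"
  have "connected (ball p e \<inter> ?H)"
    by (intro convex_connected convex_Int convex_ball convex_halfspace_Im_ge)
  then have "connected ((V \<inter> ?H) \<union> (ball p e \<inter> ?H))"
    using q by (intro connected_Un tubeD(4)[OF tube]) auto
  then have "connected ((V \<union> ball p e) \<inter> ?H)" by (simp add: Int_Un_distrib2)
  moreover have "connected (V \<union> ball p e)"
    using q by (intro connected_Un tubeD(3)[OF tube] connected_ball) auto
  ultimately show ?thesis
    unfolding tube_def using tubeD[OF tube] e ball by auto
qed

lemma speared_connect_real:
  assumes "speared \<Omega>" and J: "J \<in> imag_units" and z: "Im z \<ge> 0" "slice_emb J z \<in> \<Omega>"
  obtains C r where "connected C" "C \<subseteq> {z. Im z \<ge> 0}" "slice_emb J ` C \<subseteq> \<Omega>"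
    "z \<in> C" "r \<in> C" "Im r = 0"
proof -
  let ?C = "connected_component_set (\<Omega> \<inter> half_slice J) (slice_emb J z)"
  have zC: "slice_emb J z \<in> ?C" using z by (simp add: slice_emb_in_half_slice)
  then have "?C \<in> components (\<Omega> \<inter> half_slice J)"
    by (metis componentsI connected_component_in connected_component_refl_eq mem_Collect_eq)
  then obtain x where x: "x \<in> ?C" "x \<in> \<real>"
    using assms(1) J unfolding speared_def by blast
  have CH: "?C \<subseteq> \<Omega> \<inter> half_slice J" by (rule connected_component_subset)
  then obtain C where C: "connected C" "C \<subseteq> {z. Im z \<ge> 0}" "slice_emb J ` C = ?C"
    using connected_slice_preimage[OF J, of ?C] by auto
  have "z \<in> C"
  proof -
    obtain w where "w \<in> C" "slice_emb J w = slice_emb J z" using zC C by (metis imageE)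
    then show ?thesis using slice_emb_unique(1)[OF J J, of w z] C z by auto
  qed
  moreover obtain r where r: "r \<in> C" "slice_emb J r = x" using x C by (metis imageE)
  moreover have "Im r = 0" using r(2) x(2) slice_emb_in_Reals_iff[OF J] by metis
  ultimately show ?thesis using that C CH by blast
qed

text \<open>A ball is a tube at the real end of a connection, and tubes can be prolonged by small
  balls. Lying in some tube is thus a locally constant property along the connected set
  \<open>C'\<close>, hence holds at \<open>z\<close>.\<close>

lemma tube_exists:
  assumes "speared \<Omega>" and J: "J \<in> imag_units" and z: "Im z \<ge> 0" "slice_emb J z \<in> \<Omega>"
  obtains e V where "z \<in> V" "tube \<Omega> J e V"
proof -
  have \<Omega>: "open \<Omega>" using assms by (simp add: speared_def)
  obtain C' r where C': "connected C'" "C' \<subseteq> {z. Im z \<ge> 0}" "slice_emb J ` C' \<subseteq> \<Omega>"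
    and zC': "z \<in> C'" and r: "r \<in> C'" "Im r = 0"
    using speared_connect_real[OF assms] .
  have in\<Omega>: "slice_emb J p \<in> \<Omega>" if "p \<in> C'" for p using that C' by blast
  \<comment> \<open>The cap radius depends on the point, which leaves room for the shrinking in
    \<open>tube_union_ball\<close>.\<close>
  let ?P = "\<lambda>p. \<exists>e V. p \<in> V \<and> tube \<Omega> J e V"
  have "?P r"
  proof -
    obtain e where e: "e > 0" "\<And>w K. w \<in> ball r e \<Longrightarrow> K \<in> ball J e \<Longrightarrow> slice_emb K w \<in> \<Omega>"
      by (rule slice_emb_local[OF \<Omega> in\<Omega>[OF r(1)]]) blast
    have "connected (ball r e \<inter> {z. Im z \<ge> 0})"
      by (intro convex_connected convex_Int convex_ball convex_halfspace_Im_ge)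
    moreover have "r = complex_of_real (Re r)" using r by (simp add: complex_eq_iff)
    ultimately have "tube \<Omega> J e (ball r e)"
      unfolding tube_def using e by (auto intro!: exI[of _ "Re r"])
    then show ?thesis using e(1) by (metis centre_in_ball)
  qed
  have "?P r \<longleftrightarrow> ?P z"
  proof (rule connected_equivalence_relation[OF C'(1) r(1) zC', where R = "\<lambda>p q. ?P p \<longleftrightarrow> ?P q"])
    fix p assume p: "p \<in> C'"
    obtain e where e: "e > 0" "\<And>w K. w \<in> ball p e \<Longrightarrow> K \<in> ball J e \<Longrightarrow> slice_emb K w \<in> \<Omega>"
      by (rule slice_emb_local[OF \<Omega> in\<Omega>[OF p]]) blast
    have step: "?P b" if "?P a" "a \<in> C'" "a \<in> ball p e" "b \<in> ball p e" for a b
    proof -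
      from that(1) obtain d V where V: "a \<in> V" "tube \<Omega> J d V" by blast
      have "tube \<Omega> J (min d e) (V \<union> ball p e)"
        using tube_union_ball[OF V(2) e V(1) that(3)] that(2) C'(2) by auto
      then show ?thesis using that(4) by blast
    qed
    have pp: "p \<in> ball p e" using e by simp
    show "\<exists>T. openin (top_of_set C') T \<and> p \<in> T \<and> (\<forall>q\<in>T. ?P p \<longleftrightarrow> ?P q)"
    proof (intro exI conjI ballI)
      show "openin (top_of_set C') (C' \<inter> ball p e)" by (simp add: openin_open_Int)
      show "p \<in> C' \<inter> ball p e" using p pp by simp
      fix q assume q: "q \<in> C' \<inter> ball p e"
      show "?P p \<longleftrightarrow> ?P q" using step[OF _ p pp, of q] step[of q p] q pp by blast
    qed
  qed auto
  with \<open>?P r\<close> that show ?thesis by blast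
qed

text \<open>Unlike \<^const>\<open>stem_J\<close>, this is not extended to the lower half plane by conjugation, so that it is
  holomorphic in full neighbourhoods of real points without further argument.\<close>

definition stem_germ :: "(quat \<Rightarrow> quat) \<Rightarrow> quat \<Rightarrow> complex \<Rightarrow> quat_cx" where
  "stem_germ f J w = (THE p. \<forall>\<^sub>F K in at J within imag_units. rep_pair f J K w = p)"

text \<open>On a nontrivial filter two eventual values are compared at a common point. The predicate
  \<open>P\<close> accommodates the domain condition in \<open>stem_J\<close>.\<close>

lemma THE_eventually_eq:
  assumes "F \<noteq> bot" "\<forall>\<^sub>F x in F. P x \<and> g x = c"
  shows "(THE w. \<forall>\<^sub>F x in F. P x \<and> g x = w) = c"
proof (rule the_equality)
  show "w = c" if "\<forall>\<^sub>F x in F. P x \<and> g x = w" for w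
    using eventually_happens'[OF assms(1) eventually_conj[OF assms(2) that]] by auto
qed (rule assms)

lemma stem_germ_eqI:
  assumes "J \<in> imag_units" "\<forall>\<^sub>F K in at J within imag_units. rep_pair f J K w = p"
  shows "stem_germ f J w = p"
  using THE_eventually_eq[OF at_imag_unit_not_bot[OF assms(1)], of "\<lambda>_. True"] assms
  by (simp add: stem_germ_def)

lemma eventually_imag_unit_near:
  assumes "K \<in> ball J e"
  shows "\<forall>\<^sub>F N in at K within imag_units. N \<in> imag_units \<and> N \<noteq> K \<and> N \<in> ball J e"
proof -
  have "\<forall>\<^sub>F N in nhds K. N \<in> ball J e"
    using assms by (intro eventually_nhds_in_open) auto
  then show ?thesis
    unfolding eventually_at_filter by eventually_elim auto
qed

section \<open>Germs of the stem family inside a tube\<close>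

locale slice_function =
  fixes \<Omega> :: "quat set" and f :: "quat \<Rightarrow> quat"
  assumes speared: "speared \<Omega>" and regular: "slice_regular f \<Omega>"
begin

lemma open_Omega: "open \<Omega>"
  using speared by (simp add: speared_def)

lemma tube_rep_pair:
  assumes tube: "tube \<Omega> J e V" and "w \<in> V"
    and "K \<in> imag_units" "L \<in> imag_units" "M \<in> imag_units" "N \<in> imag_units"
    and "K \<in> ball J e" "L \<in> ball J e" "M \<in> ball J e" "N \<in> ball J e"
    and "K \<noteq> L" "M \<noteq> N"
  shows "rep_pair f K L w = rep_pair f M N w"
proof -
  obtain r where "complex_of_real r \<in> V" using tubeD(5)[OF tube] ..
  moreover have "V \<subseteq> slice_dom \<Omega> {K, L, M, N}"
    using assms tubeD(6)[OF tube] by (auto simp: slice_dom_def)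
  ultimately show ?thesis
    using assms tubeD(3)[OF tube] by (intro rep_pair_unique[OF regular open_Omega]) auto
qed

text \<open>Units \<open>N\<close> close to \<open>K\<close> still lie in the cap, where all pairs
  of distinct units give the same coefficients.\<close>

lemma tube_germ:
  assumes "tube \<Omega> J e V" "w \<in> V"
    and "K \<in> imag_units" "L \<in> imag_units" "M \<in> imag_units"
    and "K \<in> ball J e" "L \<in> ball J e" "M \<in> ball J e" "L \<noteq> M"
  shows "stem_germ f K w = rep_pair f L M w"
proof (rule stem_germ_eqI)
  show "\<forall>\<^sub>F N in at K within imag_units. rep_pair f K N w = rep_pair f L M w"
    using eventually_imag_unit_near[OF assms(6)]
    by eventually_elim (use assms tube_rep_pair in blast)
qed fact

lemma tube_germ_const:
  assumes tube: "tube \<Omega> J e V" "w \<in> V" and "J \<in> imag_units" "K \<in> imag_units" "K \<in> ball J e"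
  shows "stem_germ f K w = stem_germ f J w"
proof -
  have e: "e > 0" using tubeD(1)[OF tube(1)] .
  obtain L where "L \<in> imag_units" "L \<noteq> J" "L \<in> ball J e"
    using imag_unit_near[OF assms(3) e] .
  then have "stem_germ f M w = rep_pair f J L w" if "M \<in> imag_units" "M \<in> ball J e" for M
    using that e by (intro tube_germ[OF tube]) (use assms in auto)
  then show ?thesis using assms e by simp
qed

lemma tube_affine:
  assumes tube: "tube \<Omega> J e V" "w \<in> V" and "J \<in> imag_units" "K \<in> imag_units" "K \<in> ball J e"
  shows "f (slice_emb K w) = fst (stem_germ f J w) + K * snd (stem_germ f J w)"
proof -
  \<comment> \<open>With this radius around \<open>K\<close> the triangle inequality keeps the
    second node \<open>L\<close> in the cap around \<open>J\<close>.\<close>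
  have "e - dist J K > 0" using assms(5) by simp
  then obtain L where L: "L \<in> imag_units" "L \<noteq> K" "L \<in> ball K (e - dist J K)"
    using imag_unit_near[OF assms(4)] by blast
  then have "L \<in> ball J e" using dist_triangle[of J L K] by simp
  with L have "stem_germ f J w = rep_pair f K L w"
    using tubeD(1)[OF tube(1)] assms by (intro tube_germ[OF tube]) auto
  then show ?thesis using rep_pair_affine[of K L f w] assms(4) L by (simp add: rep_pair_def)
qed

text \<open>On the open set \<open>V\<close> the germ coincides with a single pair, whose second
  node \<open>L\<close> is fixed in the cap; holomorphy is inherited from it.\<close>

lemma stem_holo_germ:
  assumes tube: "tube \<Omega> J e V" and J: "J \<in> imag_units"
  shows "stem_holo (stem_germ f J) V"
proof -
  have e: "e > 0" "open V" using tubeD[OF tube] by auto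
  obtain L where L: "L \<in> imag_units" "L \<noteq> J" "L \<in> ball J e"
    using imag_unit_near[OF J e(1)] .
  have eq: "rep_pair f J L w = stem_germ f J w" if "w \<in> V" for w
    using that e by (intro tube_germ[OF tube, symmetric]) (use J L in auto)
  have "V \<subseteq> slice_dom \<Omega> {J, L}"
    using tubeD(6)[OF tube] J L e by (auto simp: slice_dom_def)
  with stem_holo_rep_pair[OF regular J L(1)] have h: "stem_holo (rep_pair f J L) V"
    by (rule stem_holo_subset)
  show ?thesis
    unfolding stem_holo_def
  proof
    fix w assume w: "w \<in> V"
    with h obtain a b where "(rep_pair f J L has_derivative
       (\<lambda>h. (Re h *\<^sub>R a - Im h *\<^sub>R b, Re h *\<^sub>R b + Im h *\<^sub>R a))) (at w)"
      by (auto simp: stem_holo_def)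
    then have "(stem_germ f J has_derivative
       (\<lambda>h. (Re h *\<^sub>R a - Im h *\<^sub>R b, Re h *\<^sub>R b + Im h *\<^sub>R a))) (at w)"
      by (rule has_derivative_transform_within_open[OF _ e(2) w eq])
    then show "\<exists>a b. (stem_germ f J has_derivative
       (\<lambda>h. (Re h *\<^sub>R a - Im h *\<^sub>R b, Re h *\<^sub>R b + Im h *\<^sub>R a))) (at w)" by blast
  qed
qed

text \<open>Agreement on a full neighbourhood, not just at \<open>z\<close>, is what the identity
  principle can propagate.\<close>

definition germ_eq :: "quat \<Rightarrow> quat \<Rightarrow> complex \<Rightarrow> bool" where
  "germ_eq J K z \<longleftrightarrow> (\<forall>\<^sub>F w in nhds z. stem_germ f J w = stem_germ f K w)"

lemma germ_eq_refl: "germ_eq J J z"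
  by (simp add: germ_eq_def)

lemma germ_eq_sym: "germ_eq J K z \<Longrightarrow> germ_eq K J z"
  by (simp add: germ_eq_def eq_commute)

lemma germ_eq_trans: "germ_eq J K z \<Longrightarrow> germ_eq K L z \<Longrightarrow> germ_eq J L z"
  unfolding germ_eq_def by (auto elim: eventually_elim2)

text \<open>A ball about a real point embeds into \<open>\<Omega>\<close> in all slices at once, so
  \<open>rep_pair_unique\<close> compares arbitrary pairs of units on it, however far apart.\<close>

lemma germ_eq_real:
  assumes J: "J \<in> imag_units" and K: "K \<in> imag_units" and "slice_emb J z \<in> \<Omega>" "Im z = 0"
  shows "germ_eq J K z"
proof -
  obtain e where e: "e > 0" "ball (of_real (Re z)) e \<subseteq> \<Omega>"
    using assms open_Omega open_contains_ball slice_emb_real by metis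
  have z: "z = complex_of_real (Re z)" using assms by (simp add: complex_eq_iff)
  have mem: "slice_emb M w \<in> \<Omega>" if "M \<in> imag_units" "w \<in> ball z e" for M w
  proof -
    have "slice_emb M w \<in> ball (of_real (Re z)) e"
      using that(2) dist_slice_emb_real[OF that(1), of w "Re z"] z by (simp add: dist_commute)
    then show ?thesis using e by blast
  qed
  have "connected (ball z e \<inter> {z. Im z \<ge> 0})"
    by (intro convex_connected convex_Int convex_ball convex_halfspace_Im_ge)
  \<comment> \<open>The cap radius 1 is arbitrary: every unit maps this ball into
    \<open>\<Omega>\<close>.\<close>
  then have tube: "tube \<Omega> M 1 (ball z e)" for M
    unfolding tube_def using e mem z by (auto intro!: exI[of _ "Re z"])
  obtain J' where J': "J' \<in> imag_units" "J' \<noteq> J" "J' \<in> ball J 1"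
    using imag_unit_near[OF J, of 1] by auto
  obtain K' where K': "K' \<in> imag_units" "K' \<noteq> K" "K' \<in> ball K 1"
    using imag_unit_near[OF K, of 1] by auto
  have "stem_germ f J w = stem_germ f K w" if w: "w \<in> ball z e" for w
  proof -
    have "stem_germ f J w = rep_pair f J J' w"
      by (rule tube_germ[OF tube w]) (use J J' in auto)
    also have "\<dots> = rep_pair f K K' w"
      by (rule rep_pair_unique[OF regular open_Omega, where C = "ball z e" and r = "Re z"])
        (use J J' K K' w mem e z in \<open>auto simp: slice_dom_def\<close>)
    also have "\<dots> = stem_germ f K w"
      by (rule tube_germ[OF tube w, symmetric]) (use K K' in auto)
    finally show ?thesis .
  qed
  then show ?thesis
    unfolding germ_eq_def eventually_nhds by (intro exI[of _ "ball z e"]) (use e in auto)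
qed

lemma germ_eq_tube:
  assumes "tube \<Omega> J e V" "z \<in> V" "J \<in> imag_units" "K \<in> imag_units" "K \<in> ball J e"
  shows "germ_eq J K z"
  unfolding germ_eq_def eventually_nhds
  using tube_germ_const[OF assms(1) _ assms(3-5)] tubeD(2)[OF assms(1)] assms(2)
  by (intro exI[of _ V]) auto

text \<open>Near each point of \<open>S\<close> a tube around \<open>J\<close> and one around
  \<open>K\<close> provide a ball on which both stem functions are holomorphic. Equality of germs is
  therefore locally constant along \<open>S\<close>, although no single tube need contain
  \<open>S\<close>.\<close>

lemma germ_eq_propagate:
  assumes J: "J \<in> imag_units" and K: "K \<in> imag_units"
    and S: "connected S" "S \<subseteq> stem_E \<Omega> J K" "z \<in> S" "z' \<in> S"
    and eq: "germ_eq J K z"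
  shows "germ_eq J K z'"
proof -
  have mem: "Im p \<ge> 0" "slice_emb J p \<in> \<Omega>" "slice_emb K p \<in> \<Omega>" if "p \<in> S" for p
  proof -
    have p: "slice_emb J p \<in> \<Omega>" "slice_emb K p \<in> \<Omega>" "slice_emb J p \<in> half_slice J"
      using that S by (auto simp: stem_E_def)
    then obtain w where w: "slice_emb J p = slice_emb J w" "Im w \<ge> 0" by (auto simp: half_slice_def)
    then show "Im p \<ge> 0" using inner_slice_emb[OF J] by metis
    show "slice_emb J p \<in> \<Omega>" "slice_emb K p \<in> \<Omega>" using p by auto
  qed
  have "germ_eq J K z \<longleftrightarrow> germ_eq J K z'"
  proof (rule connected_equivalence_relation[OF S(1,3,4),
        where R = "\<lambda>p q. germ_eq J K p \<longleftrightarrow> germ_eq J K q"])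
    fix p assume p: "p \<in> S"
    obtain d V where V: "p \<in> V" "tube \<Omega> J d V"
      using tube_exists[OF speared J] mem[OF p] by blast
    obtain e W where W: "p \<in> W" "tube \<Omega> K e W"
      using tube_exists[OF speared K] mem[OF p] by blast
    have "open (V \<inter> W)" using V W by (auto dest: tubeD)
    then obtain r where r: "r > 0" "ball p r \<subseteq> V \<inter> W"
      using V W open_contains_ball by blast
    have "germ_eq J K b" if "germ_eq J K a" "a \<in> ball p r" "b \<in> ball p r" for a b
    proof -
      have hJ: "stem_holo (stem_germ f J) (ball p r)" and hK: "stem_holo (stem_germ f K) (ball p r)"
        using stem_holo_subset stem_holo_germ[OF V(2) J] stem_holo_germ[OF W(2) K] r by blast+
      have "stem_germ f J w = stem_germ f K w" if "w \<in> ball p r" for w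
        using stem_identity_open[OF hJ hK open_ball connected_ball \<open>a \<in> ball p r\<close>] that
          \<open>germ_eq J K a\<close> unfolding germ_eq_def by blast
      then show ?thesis
        unfolding germ_eq_def eventually_nhds using that by (intro exI[of _ "ball p r"]) auto
    qed
    then have "germ_eq J K p \<longleftrightarrow> germ_eq J K q" if "q \<in> S \<inter> ball p r" for q
      using that r(1) by (meson Int_iff centre_in_ball)
    then show "\<exists>T. openin (top_of_set S) T \<and> p \<in> T \<and> (\<forall>q\<in>T. germ_eq J K p \<longleftrightarrow> germ_eq J K q)"
      using p r(1) by (intro exI[of _ "S \<inter> ball p r"]) (auto simp: openin_open_Int)
  qed auto
  with eq show ?thesis by simp
qed

end

section \<open>Spherical values and spherical derivatives\<close>

definition quat_vec :: "quat \<Rightarrow> quat" where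
  "quat_vec q = q - of_real (qRe q)"

definition quat_point :: "quat \<Rightarrow> complex" where
  "quat_point q = Complex (qRe q) (norm (quat_vec q))"

text \<open>At a real point the value is 0, which is not an imaginary unit; hence the recurring
  condition \<open>quat_vec q \<noteq> 0\<close>.\<close>

definition quat_unit :: "quat \<Rightarrow> quat" where
  "quat_unit q = quat_vec q /\<^sub>R norm (quat_vec q)"

lemma quat_polar:
  assumes "quat_vec q \<noteq> 0"
  shows "quat_unit q \<in> imag_units" "Im (quat_point q) > 0"
    "slice_emb (quat_unit q) (quat_point q) = q"
  using assms by (auto simp: imag_units_iff quat_unit_def quat_point_def slice_emb_alt)
    (simp_all add: quat_vec_def of_real_def)

lemma quat_polar_slice_emb:
  assumes "J \<in> imag_units" "Im z > 0"
  shows "quat_vec (slice_emb J z) \<noteq> 0" "quat_unit (slice_emb J z) = J"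
    "quat_point (slice_emb J z) = z"
proof -
  have v: "quat_vec (slice_emb J z) = Im z *\<^sub>R J"
    unfolding quat_vec_def qRe_slice_emb[OF assms(1)] by (simp add: slice_emb_alt of_real_def)
  have n: "norm J = 1" using assms by (simp add: imag_units_iff)
  then have "J \<noteq> 0" by auto
  then show "quat_vec (slice_emb J z) \<noteq> 0" "quat_unit (slice_emb J z) = J"
    "quat_point (slice_emb J z) = z"
    using assms v n by (simp_all add: quat_unit_def quat_point_def qRe_slice_emb)
qed

lemma continuous_on_quat_vec [continuous_intros]: "continuous_on A quat_vec"
proof -
  have eq: "quat_vec = (\<lambda>q. q - of_real (inner q 1))"
    by (simp add: fun_eq_iff quat_vec_def inner_quat_def)
  show ?thesis unfolding eq by (intro continuous_intros)
qed

lemma continuous_on_quat_point: "continuous_on A quat_point"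
proof -
  have eq: "quat_point = (\<lambda>q. of_real (inner q 1) + \<i> * of_real (norm (quat_vec q)))"
    by (simp add: fun_eq_iff quat_point_def inner_quat_def complex_eq_iff)
  show ?thesis unfolding eq by (intro continuous_intros)
qed

lemma convex_half_slice: "convex (half_slice J)"
proof -
  have "linear (slice_emb J)"
    by (rule linearI) (simp_all add: slice_emb_alt scaleR_add_left scaleR_add_right)
  then show ?thesis
    unfolding half_slice_def by (intro convex_linear_image convex_halfspace_Im_ge)
qed

lemma real_mem_half_slice: "of_real r \<in> half_slice J"
  using slice_emb_in_half_slice[of "of_real r" J] by (simp add: slice_emb_real)

lemma half_slice_cases:
  assumes "q \<in> half_slice J"
  obtains z where "Im z \<ge> 0" "q = slice_emb J z"
  using assms by (auto simp: half_slice_def)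

text \<open>A ball about a real point is symmetric, since the distance to its centre does not see
  the unit, and speared, since its half slices are convex and contain the centre.\<close>

lemma real_mem_core:
  assumes "open \<Omega>" "of_real r \<in> \<Omega>"
  shows "of_real r \<in> core \<Omega>"
proof -
  obtain e where e: "e > 0" "ball (of_real r) e \<subseteq> \<Omega>"
    using assms open_contains_ball by blast
  let ?B = "ball (of_real r :: quat) e"
  have "symmetric_set ?B"
    unfolding symmetric_set_def
    by (simp add: dist_slice_emb_real dist_commute[of "of_real r :: quat"])
  moreover have "speared ?B"
    unfolding speared_def
  proof (intro conjI ballI)
    fix I C assume C: "C \<in> components (?B \<inter> half_slice I)"
    have "connected (?B \<inter> half_slice I)"
      by (intro convex_connected convex_Int convex_ball convex_half_slice)
    then have "C = ?B \<inter> half_slice I"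
      using C by (metis connected_eq_components_subset_sing singletonD subsetD)
    moreover have "of_real r \<in> ?B \<inter> half_slice I"
      using e by (simp add: real_mem_half_slice)
    ultimately show "C \<inter> \<real> \<noteq> {}" using Reals_of_real by blast
  qed simp
  ultimately have "?B \<subseteq> core \<Omega>" using core_largest(4) e by blast
  then show ?thesis using e by auto
qed

text \<open>Phrased in polar coordinates so that openness follows by taking a preimage. Real points
  have no polar unit; those of \<open>\<Omega>\<close> belong to the core.\<close>

definition tube_part :: "quat set \<Rightarrow> quat \<Rightarrow> quat set" where
  "tube_part \<Omega> J = {q. quat_vec q \<noteq> 0 \<and>
     (\<exists>e V. tube \<Omega> J e V \<and> quat_point q \<in> V \<and> quat_unit q \<in> ball J e)}"

lemma slice_emb_in_tube_part_iff:
  assumes "K \<in> imag_units" "Im z > 0"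
  shows "slice_emb K z \<in> tube_part \<Omega> J \<longleftrightarrow> (\<exists>e V. tube \<Omega> J e V \<and> z \<in> V \<and> K \<in> ball J e)"
  using quat_polar_slice_emb[OF assms] by (simp add: tube_part_def)

lemma tube_part_subset: "tube_part \<Omega> J \<subseteq> \<Omega>"
proof
  fix q assume "q \<in> tube_part \<Omega> J"
  then obtain e V where q: "quat_vec q \<noteq> 0" "tube \<Omega> J e V" "quat_point q \<in> V" "quat_unit q \<in> ball J e"
    by (auto simp: tube_part_def)
  then show "q \<in> \<Omega>" using tubeD(6)[OF q(2)] quat_polar[OF q(1)] by metis
qed

lemma open_tube_part: "open (tube_part \<Omega> J)"
proof -
  let ?N = "{q. quat_vec q \<noteq> 0}"
  let ?T = "\<Union>(e, V)\<in>{(e, V). tube \<Omega> J e V}. V \<times> ball J e"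
  have "open ?N" by (intro open_Collect_neq continuous_intros)
  moreover have "continuous_on ?N (\<lambda>q. (quat_point q, quat_unit q))"
    unfolding quat_unit_def by (intro continuous_intros continuous_on_quat_point) auto
  moreover have "open ?T" by (auto intro!: open_UN open_Times dest: tubeD(2))
  ultimately have "open (?N \<inter> (\<lambda>q. (quat_point q, quat_unit q)) -` ?T)"
    using continuous_open_preimage by blast
  moreover have "tube_part \<Omega> J = ?N \<inter> (\<lambda>q. (quat_point q, quat_unit q)) -` ?T"
    by (auto simp: tube_part_def; blast)
  ultimately show ?thesis by simp
qed

section \<open>Representation formula and well-definedness of spherical values\<close>

context slice_function
begin

text \<open>Along a connection to a real point inside the core, symmetry keeps every slice in
  \<open>\<Omega>\<close>, so \<open>rep_pair_unique\<close> applies without any bound on the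
  distances of the units.\<close>

lemma core_affine:
  assumes I: "I \<in> imag_units" and J: "J \<in> imag_units" and K: "K \<in> imag_units" and "J \<noteq> K"
    and z: "Im z \<ge> 0" "slice_emb I z \<in> core \<Omega>"
  shows "f (slice_emb I z) = rep_fst f J K z + I * rep_snd f J K z"
proof -
  obtain C r where C: "connected C" "slice_emb I ` C \<subseteq> core \<Omega>" "z \<in> C" "r \<in> C" "Im r = 0"
    using speared_connect_real[OF core_largest(3) I z] by metis
  have "slice_emb M w \<in> \<Omega>" if "M \<in> imag_units" "w \<in> C" for M w
    using that C(2) I core_largest(1,2)[of \<Omega>] unfolding symmetric_set_def by blast
  then have sub: "C \<subseteq> slice_dom \<Omega> {I, L, J, K}" if "L \<in> imag_units" for L
    using that I J K by (auto simp: slice_dom_def)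
  have r: "r = complex_of_real (Re r)" using C by (simp add: complex_eq_iff)
  \<comment> \<open>One of \<open>J\<close> and \<open>K\<close> differs from \<open>I\<close> and
    serves as second node.\<close>
  obtain L where L: "L \<in> imag_units" "I \<noteq> L" using J K \<open>J \<noteq> K\<close> by metis
  have "rep_pair f I L z = rep_pair f J K z"
    using rep_pair_unique[OF regular open_Omega I L(1) J K L(2) \<open>J \<noteq> K\<close> C(1) sub[OF L(1)]] C r
    by metis
  then show ?thesis
    using rep_pair_affine[OF I L, of f z] by (simp add: rep_pair_def)
qed

text \<open>Core points reach the real axis inside the core, tube points inside the upper half of
  their tube. The representation formula comes from \<open>core_affine\<close> in the first case and
  from \<open>tube_affine\<close> in the second.\<close>

lemma rep_domain_exists:
  assumes J0: "J\<^sub>0 \<in> imag_units"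
  shows "rep_domain \<Omega> f J\<^sub>0 (core \<Omega> \<union> tube_part \<Omega> J\<^sub>0)"
proof -
  let ?L = "core \<Omega> \<union> tube_part \<Omega> J\<^sub>0"
  have real: "slice_emb K z \<in> core \<Omega>" if "slice_emb K z \<in> \<Omega>" "Im z = 0" for K z
    using that real_mem_core[OF open_Omega] by (simp add: slice_emb_real)
  have "speared ?L"
    unfolding speared_def
  proof (intro conjI ballI)
    show "open ?L" using core_largest(3)[of \<Omega>] open_tube_part by (auto simp: speared_def)
    fix I C assume I: "I \<in> imag_units" and "C \<in> components (?L \<inter> half_slice I)"
    then obtain p where p: "p \<in> ?L" "p \<in> half_slice I"
      and C: "C = connected_component_set (?L \<inter> half_slice I) p"
      by (auto simp: components_def)
    obtain z where z: "Im z \<ge> 0" "p = slice_emb I z" using half_slice_cases[OF p(2)] .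
    obtain D r where D: "connected D" "D \<subseteq> {z. Im z \<ge> 0}" "slice_emb I ` D \<subseteq> ?L"
      "z \<in> D" "r \<in> D" "Im r = 0"
    proof (cases "p \<in> core \<Omega>")
      case True
      then have "slice_emb I z \<in> core \<Omega>" using z by simp
      then obtain D r where "connected D" "D \<subseteq> {z. Im z \<ge> 0}" "slice_emb I ` D \<subseteq> core \<Omega>"
        "z \<in> D" "r \<in> D" "Im r = 0"
        using speared_connect_real[OF core_largest(3) I z(1)] by blast
      then show ?thesis by (intro that[of D r]) auto
    next
      case False
      then have pt: "slice_emb I z \<in> tube_part \<Omega> J\<^sub>0" using p z by simp
      then have "Im z \<noteq> 0" using tube_part_subset real False z by blast
      then have "Im z > 0" using z by simp
      then obtain e V where V: "tube \<Omega> J\<^sub>0 e V" "z \<in> V" "I \<in> ball J\<^sub>0 e"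
        using pt slice_emb_in_tube_part_iff[OF I] by blast
      obtain r where r: "complex_of_real r \<in> V" using tubeD(5)[OF V(1)] ..
      have "slice_emb I w \<in> ?L" if "w \<in> V" "Im w \<ge> 0" for w
      proof (cases "Im w = 0")
        case True
        then show ?thesis using real tubeD(6)[OF V(1) that(1) I V(3)] by blast
      next
        case False
        then show ?thesis using that slice_emb_in_tube_part_iff[OF I, of w] V by auto
      qed
      then show ?thesis
        using z r V by (intro that[of "V \<inter> {z. Im z \<ge> 0}" "of_real r"] tubeD(4)[OF V(1)]) auto
    qed
    have "slice_emb I ` D \<subseteq> C"
      unfolding C
    proof (rule connected_component_maximal)
      show "connected (slice_emb I ` D)"
        by (intro connected_continuous_image continuous_intros D)
    qed (use D z in \<open>auto intro: slice_emb_in_half_slice\<close>)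
    moreover have "slice_emb I r \<in> \<real>" using D by (simp add: slice_emb_real)
    ultimately show "C \<inter> \<real> \<noteq> {}" using D by blast
  qed
  moreover have "?L \<subseteq> \<Omega>" using core_largest(1) tube_part_subset by blast
  moreover have "\<Omega> \<inter> half_slice J\<^sub>0 \<subseteq> ?L"
  proof
    fix p assume p: "p \<in> \<Omega> \<inter> half_slice J\<^sub>0"
    then obtain z where z: "Im z \<ge> 0" "p = slice_emb J\<^sub>0 z" using half_slice_cases by blast
    show "p \<in> ?L"
    proof (cases "Im z = 0")
      case True
      then show ?thesis using real p z by blast
    next
      case False
      obtain e V where V: "z \<in> V" "tube \<Omega> J\<^sub>0 e V"
        using tube_exists[OF speared J0 z(1)] p z by blast
      then have "p \<in> tube_part \<Omega> J\<^sub>0"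
        using z False slice_emb_in_tube_part_iff[OF J0, of z] tubeD(1)[OF V(2)] by auto
      then show ?thesis ..
    qed
  qed
  moreover have "f (slice_emb I z) = rep_fst f J K z + I * rep_snd f J K z"
    if units: "I \<in> imag_units" "J \<in> imag_units" "K \<in> imag_units" and "J \<noteq> K" "Im z \<ge> 0"
      and L: "slice_emb I z \<in> ?L" "slice_emb J z \<in> ?L" "slice_emb K z \<in> ?L" for z I J K
  proof (cases "slice_emb I z \<in> core \<Omega>")
    case True
    then show ?thesis using that core_affine by blast
  next
    case False
    \<comment> \<open>By symmetry the core contains the points over \<open>z\<close> for all units
      or for none, so mixed configurations do not occur: here all three points lie in the tube part
      and share the coefficients given by the germ at \<open>J\<^sub>0\<close>.\<close>
    have core: "slice_emb M z \<notin> core \<Omega>" if "M \<in> imag_units" for M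
      using False that units core_largest(2)[of \<Omega>] unfolding symmetric_set_def by blast
    have "slice_emb I z \<in> \<Omega>" using L core[OF units(1)] tube_part_subset by blast
    then have "Im z > 0" using real[of I z] core[OF units(1)] \<open>Im z \<ge> 0\<close> by fastforce
    have aff: "f (slice_emb M z) = fst (stem_germ f J\<^sub>0 z) + M * snd (stem_germ f J\<^sub>0 z)"
      if M: "M \<in> imag_units" "slice_emb M z \<in> ?L" for M
    proof -
      obtain e V where "tube \<Omega> J\<^sub>0 e V" "z \<in> V" "M \<in> ball J\<^sub>0 e"
        using M core[OF M(1)] slice_emb_in_tube_part_iff[OF M(1) \<open>Im z > 0\<close>] by blast
      then show ?thesis using tube_affine J0 M by blast
    qed
    have "rep_pair f J K z = (fst (stem_germ f J\<^sub>0 z), snd (stem_germ f J\<^sub>0 z))"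
      by (rule rep_pair_eqI) (use units L aff \<open>J \<noteq> K\<close> in auto)
    then show ?thesis using aff[OF units(1) L(1)] by (simp add: rep_pair_def prod_eq_iff)
  qed
  ultimately show ?thesis unfolding rep_domain_def by blast
qed

text \<open>Openness puts the points over \<open>z\<close> with unit \<open>M\<close> near
  \<open>J\<^sub>0\<close> into \<open>\<Lambda>\<close>. The formula on \<open>\<Lambda>\<close>
  says that the coefficients from \<open>J\<close> and \<open>K\<close> also interpolate
  \<open>f\<close> at \<open>J\<^sub>0\<close> and \<open>M\<close>, so \<open>rep_pair_eqI\<close>
  identifies the pairs.\<close>

lemma rep_domain_germ:
  assumes L: "rep_domain \<Omega> f J\<^sub>0 \<Lambda>" and J0: "J\<^sub>0 \<in> imag_units" and z: "Im z \<ge> 0" "slice_emb J\<^sub>0 z \<in> \<Omega>"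
    and J: "J \<in> imag_units" "slice_emb J z \<in> \<Lambda>" and K: "K \<in> imag_units" "slice_emb K z \<in> \<Lambda>"
    and "J \<noteq> K"
  shows "rep_pair f J K z = stem_germ f J\<^sub>0 z"
proof (rule stem_germ_eqI[symmetric])
  have "slice_emb J\<^sub>0 z \<in> \<Lambda>" "open \<Lambda>"
    using L z slice_emb_in_half_slice unfolding rep_domain_def speared_def by blast+
  then obtain e where e: "e > 0" "\<And>w K. w \<in> ball z e \<Longrightarrow> K \<in> ball J\<^sub>0 e \<Longrightarrow> slice_emb K w \<in> \<Lambda>"
    using slice_emb_local by blast
  then have "J\<^sub>0 \<in> ball J\<^sub>0 e" by simp
  from eventually_imag_unit_near[OF this]
  show "\<forall>\<^sub>F M in at J\<^sub>0 within imag_units. rep_pair f J\<^sub>0 M z = rep_pair f J K z"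
  proof eventually_elim
    fix M assume M: "M \<in> imag_units \<and> M \<noteq> J\<^sub>0 \<and> M \<in> ball J\<^sub>0 e"
    then have "slice_emb M z \<in> \<Lambda>" using e by simp
    moreover have "f (slice_emb N z) = rep_fst f J K z + N * rep_snd f J K z"
      if "N \<in> imag_units" "slice_emb N z \<in> \<Lambda>" for N
      using L that J K \<open>J \<noteq> K\<close> z unfolding rep_domain_def by blast
    ultimately show "rep_pair f J\<^sub>0 M z = rep_pair f J K z"
      unfolding rep_pair_def[of f J K]
      by (intro rep_pair_eqI) (use M J0 \<open>slice_emb J\<^sub>0 z \<in> \<Lambda>\<close> in auto)
  qed
qed fact

text \<open>Off the real axis the point determines \<open>z\<close> and its unit, and by
  \<open>rep_domain_germ\<close> every admissible choice yields the germ;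
  \<open>rep_domain_exists\<close> shows that a choice exists.\<close>

lemma spherical_eq_germ:
  assumes J0: "J\<^sub>0 \<in> imag_units" and z: "Im z > 0" "slice_emb J\<^sub>0 z \<in> \<Omega>"
  shows "spherical_value \<Omega> f (slice_emb J\<^sub>0 z) = fst (stem_germ f J\<^sub>0 z)"
    and "spherical_deriv \<Omega> f (slice_emb J\<^sub>0 z) =
      inverse (of_real (Im z)) * snd (stem_germ f J\<^sub>0 z)"
proof -
  let ?L = "core \<Omega> \<union> tube_part \<Omega> J\<^sub>0"
  have L: "rep_domain \<Omega> f J\<^sub>0 ?L" using rep_domain_exists[OF J0] .
  have mem: "slice_emb J\<^sub>0 z \<in> ?L" and "open ?L"
    using L z slice_emb_in_half_slice[of z J\<^sub>0] unfolding rep_domain_def speared_def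
    by (auto simp: subset_iff)
  then obtain e where e: "e > 0" "\<And>w K. w \<in> ball z e \<Longrightarrow> K \<in> ball J\<^sub>0 e \<Longrightarrow> slice_emb K w \<in> ?L"
    using slice_emb_local by blast
  obtain K where K: "K \<in> imag_units" "K \<noteq> J\<^sub>0" "K \<in> ball J\<^sub>0 e"
    using imag_unit_near[OF J0 e(1)] .
  then have KL: "slice_emb K z \<in> ?L" using e by simp
  have K0: "rep_pair f J\<^sub>0 K z = stem_germ f J\<^sub>0 z"
    by (rule rep_domain_germ[OF L J0]) (use z mem K KL J0 in auto)
  have unique: "z' = z \<and> rep_pair f J K z = stem_germ f J\<^sub>0 z"
    if "J' \<in> imag_units" "Im z' \<ge> 0" "slice_emb J\<^sub>0 z = slice_emb J' z'" "rep_domain \<Omega> f J' \<Lambda>"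
      "J \<in> imag_units" "K \<in> imag_units" "J \<noteq> K" "slice_emb J z' \<in> \<Lambda>" "slice_emb K z' \<in> \<Lambda>"
    for z' J' \<Lambda> J K
  proof -
    have "z = z'" "J\<^sub>0 = J'"
      using slice_emb_unique[OF J0 that(1) _ that(2,3)] z by auto
    then show ?thesis using rep_domain_germ[of J' \<Lambda> z J K] that z by auto
  qed
  show "spherical_value \<Omega> f (slice_emb J\<^sub>0 z) = fst (stem_germ f J\<^sub>0 z)"
    unfolding spherical_value_def
  proof (rule the_equality, goal_cases)
    case 1
    show ?case
      by (intro exI[of _ z] exI[of _ J\<^sub>0] exI[of _ ?L] exI[of _ J\<^sub>0] exI[of _ K] conjI)
        (use J0 z L K mem KL K0 in \<open>auto simp: rep_pair_def prod_eq_iff\<close>)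
  next
    case (2 v)
    then obtain z' J' \<Lambda> J K where *: "J' \<in> imag_units" "Im z' \<ge> 0"
      "slice_emb J\<^sub>0 z = slice_emb J' z'" "rep_domain \<Omega> f J' \<Lambda>"
      "J \<in> imag_units" "K \<in> imag_units" "J \<noteq> K" "slice_emb J z' \<in> \<Lambda>" "slice_emb K z' \<in> \<Lambda>"
      and v: "v = rep_fst f J K z'"
      by blast
    then have "z' = z" "rep_pair f J K z = stem_germ f J\<^sub>0 z" using unique[OF *] by auto
    then show ?case using v by (metis fst_conv rep_pair_def)
  qed
  show "spherical_deriv \<Omega> f (slice_emb J\<^sub>0 z) =
      inverse (of_real (Im z)) * snd (stem_germ f J\<^sub>0 z)"
    unfolding spherical_deriv_def
  proof (rule the_equality, goal_cases)
    case 1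
    show ?case
      by (intro exI[of _ z] exI[of _ J\<^sub>0] exI[of _ ?L] exI[of _ J\<^sub>0] exI[of _ K] conjI)
        (use J0 z L K mem KL K0 in \<open>auto simp: rep_pair_def prod_eq_iff\<close>)
  next
    case (2 v)
    then obtain z' J' \<Lambda> J K where *: "J' \<in> imag_units" "Im z' > 0"
      "slice_emb J\<^sub>0 z = slice_emb J' z'" "rep_domain \<Omega> f J' \<Lambda>"
      "J \<in> imag_units" "K \<in> imag_units" "J \<noteq> K" "slice_emb J z' \<in> \<Lambda>" "slice_emb K z' \<in> \<Lambda>"
      and v: "v = inverse (of_real (Im z')) * rep_snd f J K z'"
      by blast
    have "z' = z" "rep_pair f J K z = stem_germ f J\<^sub>0 z"
      using unique[OF *(1) _ *(3-9)] *(2) by auto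
    then show ?case using v by (metis snd_conv rep_pair_def)
  qed
qed

text \<open>A tube at \<open>z\<close> makes the pair for \<open>J\<close> and any nearby
  \<open>K\<close> equal to the germ. The second claim asks for a nonreal \<open>z\<close> because
  it evaluates the conjugated branch of \<open>stem_JK\<close>.\<close>

lemma stem_J_eq_germ:
  assumes J: "J \<in> imag_units" and z: "Im z \<ge> 0" "slice_emb J z \<in> \<Omega>"
  shows "stem_J \<Omega> f J z = stem_germ f J z"
    and "Im z > 0 \<Longrightarrow> stem_J \<Omega> f J (cnj z) = qc_cnj (stem_germ f J z)"
proof -
  obtain e V where V: "z \<in> V" "tube \<Omega> J e V" using tube_exists[OF speared J z] .
  have e: "J \<in> ball J e" using tubeD(1)[OF V(2)] by simp
  have K: "z \<in> stem_E \<Omega> J K" "rep_pair f J K z = stem_germ f J z"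
    if "K \<in> imag_units" "K \<noteq> J" "K \<in> ball J e" for K
    using that z tubeD(6)[OF V(2,1)] tube_germ[OF V(2,1) J J that(1)] e
    by (auto simp: stem_E_def slice_emb_in_half_slice)
  show "stem_J \<Omega> f J z = stem_germ f J z"
    unfolding stem_J_def
  proof (rule THE_eventually_eq[OF at_imag_unit_not_bot[OF J]])
    show "\<forall>\<^sub>F K in at J within imag_units. z \<in> stem_D \<Omega> J K \<and> stem_JK f J K z = stem_germ f J z"
      using eventually_imag_unit_near[OF e]
      by eventually_elim (use K z in \<open>auto simp: stem_D_def stem_JK_def rep_pair_def\<close>)
  qed
  show "stem_J \<Omega> f J (cnj z) = qc_cnj (stem_germ f J z)" if "Im z > 0"
    unfolding stem_J_def
  proof (rule THE_eventually_eq[OF at_imag_unit_not_bot[OF J]])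
    show "\<forall>\<^sub>F K in at J within imag_units.
        cnj z \<in> stem_D \<Omega> J K \<and> stem_JK f J K (cnj z) = qc_cnj (stem_germ f J z)"
      using eventually_imag_unit_near[OF e]
      by eventually_elim (use K that in \<open>auto simp: stem_D_def stem_JK_def rep_pair_def\<close>)
  qed
qed

end

section \<open>Hinged points\<close>

lemma quat_slice_repr:
  obtains J z where "J \<in> imag_units" "Im z \<ge> 0" "q = slice_emb J z"
proof (cases "quat_vec q = 0")
  case True
  have "Quat 0 1 0 0 \<in> imag_units"
    by (simp add: imag_units_iff norm_quat_def inner_quat_def)
  moreover have "q = slice_emb (Quat 0 1 0 0) (of_real (qRe q))"
    using True by (simp add: slice_emb_real quat_vec_def)
  ultimately show ?thesis using that[of "Quat 0 1 0 0" "of_real (qRe q)"] by simp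
next
  case False
  from quat_polar[OF this] show ?thesis using that[of "quat_unit q" "quat_point q"] by simp
qed

text \<open>The representation in \<open>two_sphere\<close> may have negative imaginary part; after
  normalisation it must use the given \<open>z\<close>.\<close>

lemma two_sphere_slice_emb:
  assumes "J \<in> imag_units" "Im z \<ge> 0" "y \<in> two_sphere (slice_emb J z)"
  obtains K where "K \<in> imag_units" "y = slice_emb K z"
proof -
  obtain z' I' J' where *: "I' \<in> imag_units" "J' \<in> imag_units" "slice_emb J z = slice_emb I' z'"
    "y = slice_emb J' z'"
    using assms(3) by (auto simp: two_sphere_def)
  obtain K w where w: "K \<in> imag_units" "Im w \<ge> 0" "slice_emb I' z' = slice_emb K w"
    "\<And>L. L \<in> imag_units \<Longrightarrow> \<exists>M\<in>imag_units. slice_emb L z' = slice_emb M w"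
    using slice_emb_nonneg_repr[OF *(1)] by blast
  have "z = w" using slice_emb_unique(1)[OF assms(1) w(1) assms(2) w(2)] * w by simp
  then show ?thesis using w(4)[OF *(2)] * that by auto
qed

text \<open>Double steps are matched like parentheses: the interval between a matching pair, and the
  interval behind it, are again balanced, so induction on the length of a balanced interval works.\<close>

lemma balanced_steps_induct:
  fixes R :: "nat \<Rightarrow> nat \<Rightarrow> bool" and a b :: "nat \<Rightarrow> nat"
  assumes refl: "\<And>i. i \<le> t \<Longrightarrow> R i i"
    and trans: "\<And>i j k. R i j \<Longrightarrow> R j k \<Longrightarrow> R i k"
    and simple: "\<And>i. i < t \<Longrightarrow> i \<notin> a ` M \<union> b ` M \<Longrightarrow> R i (Suc i)"
    and less: "\<And>m. m \<in> M \<Longrightarrow> a m < b m \<and> b m < t"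
    and double: "\<And>m. m \<in> M \<Longrightarrow> R (Suc (a m)) (b m) \<Longrightarrow> R (a m) (Suc (b m))"
    and laminar: "\<And>m n. m \<in> M \<Longrightarrow> n \<in> M \<Longrightarrow> m < n \<Longrightarrow> a m < a n \<and> (b m < a n \<or> b m > b n)"
    and "u \<le> v" "v \<le> t" "\<And>m. m \<in> M \<Longrightarrow> a m \<in> {u..<v} \<longleftrightarrow> b m \<in> {u..<v}"
  shows "R u v"
  using assms(7-)
proof (induction "v - u" arbitrary: u v rule: less_induct)
  case less: less
  note IH = less.hyps and uv = less.prems(1,2) and balanced = less.prems(3)
  show ?case
  proof (cases "u = v")
    case True
    then show ?thesis using refl uv by simp
  next
    case False
    then have "u < v" using uv by simp
    show ?thesis
    proof (cases "u \<in> a ` M \<union> b ` M")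
      case False
      then have ne: "a m \<noteq> u" "b m \<noteq> u" if "m \<in> M" for m using that by auto
      have "R (Suc u) v"
      proof (rule IH)
        fix m assume m: "m \<in> M"
        show "a m \<in> {Suc u..<v} \<longleftrightarrow> b m \<in> {Suc u..<v}"
          using balanced[OF m] ne[OF m] by auto
      qed (use \<open>u < v\<close> uv in auto)
      then show ?thesis using simple[of u] False \<open>u < v\<close> uv trans by simp
    next
      case True
      \<comment> \<open>The first index must open a pair: if it were \<open>b m\<close>, then
        \<open>a m\<close> would lie before the interval and contradict balance.\<close>
      then obtain m where m: "m \<in> M" "u = a m"
        using balanced assms(4) \<open>u < v\<close> by fastforce
      have bm: "u < b m" "b m < v" using balanced[OF m(1)] assms(4)[OF m(1)] m \<open>u < v\<close> by auto
      \<comment> \<open>Any other pair is nested with this one or disjoint from it, so it does not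
        cross the cut at \<open>b m\<close>.\<close>
      have other: "(a m < a n \<and> (b m < a n \<or> b n < b m)) \<or> (a n < a m \<and> (b n < a m \<or> b m < b n))"
        if "n \<in> M" "n \<noteq> m" for n
        using laminar[of m n] laminar[of n m] that m(1) by (cases "n < m") auto
      have "R (Suc u) (b m)"
      proof (rule IH)
        fix n assume n: "n \<in> M"
        show "a n \<in> {Suc u..<b m} \<longleftrightarrow> b n \<in> {Suc u..<b m}"
          using other[OF n] assms(4)[OF n] m by (cases "n = m") auto
      qed (use bm uv in auto)
      then have "R u (Suc (b m))" using double[OF m(1)] m(2) by simp
      moreover have "R (Suc (b m)) v"
      proof (rule IH)
        fix n assume n: "n \<in> M"
        show "a n \<in> {Suc (b m)..<v} \<longleftrightarrow> b n \<in> {Suc (b m)..<v}"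
          using other[OF n] assms(4)[OF n] balanced[OF n] m bm by (cases "n = m") auto
      qed (use bm uv in auto)
      ultimately show ?thesis using trans by blast
    qed
  qed
qed

section \<open>Equality of germs as a relation between points\<close>

context slice_function
begin

text \<open>The representation is existentially quantified because real points have no preferred
  unit; \<open>linkedD\<close> shows that its choice is immaterial.\<close>

definition linked :: "quat \<Rightarrow> quat \<Rightarrow> bool" where
  "linked p q \<longleftrightarrow> (\<exists>z. \<exists>J\<in>imag_units. \<exists>K\<in>imag_units. Im z \<ge> 0 \<and> p = slice_emb J z \<and>
     q = slice_emb K z \<and> p \<in> \<Omega> \<and> q \<in> \<Omega> \<and> germ_eq J K z)"

lemma linkedI:
  assumes "J \<in> imag_units" "K \<in> imag_units" "Im z \<ge> 0" "slice_emb J z \<in> \<Omega>" "slice_emb K z \<in> \<Omega>"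
    "germ_eq J K z"
  shows "linked (slice_emb J z) (slice_emb K z)"
  using assms unfolding linked_def by blast

text \<open>Off the real axis the representation is unique; on it any two germs agree by
  \<open>germ_eq_real\<close>.\<close>

lemma linkedD:
  assumes "linked (slice_emb J z) (slice_emb K z)"
    and J: "J \<in> imag_units" and K: "K \<in> imag_units" and z: "Im z \<ge> 0"
  shows "germ_eq J K z"
proof -
  obtain w J' K' where *: "J' \<in> imag_units" "K' \<in> imag_units" "Im w \<ge> 0"
    "slice_emb J z = slice_emb J' w" "slice_emb K z = slice_emb K' w" "slice_emb J z \<in> \<Omega>"
    "germ_eq J' K' w"
    using assms(1) unfolding linked_def by auto
  have "z = w" "Im z = 0 \<or> J = J'" "Im z = 0 \<or> K = K'"
    using slice_emb_unique[OF J *(1) z *(3,4)] slice_emb_unique[OF K *(2) z *(3,5)] by auto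
  then show ?thesis using germ_eq_real[OF J K *(6)] *(7) by blast
qed

lemma linked_refl: "p \<in> \<Omega> \<Longrightarrow> linked p p"
  by (metis quat_slice_repr germ_eq_refl linkedI)

lemma linked_sym: "linked p q \<Longrightarrow> linked q p"
  unfolding linked_def using germ_eq_sym by blast

text \<open>The two representations of \<open>q\<close> can use different units only at a real
  point, where \<open>germ_eq_real\<close> gives the conclusion directly.\<close>

lemma linked_trans:
  assumes "linked p q" "linked q r"
  shows "linked p r"
proof -
  obtain z J K where 1: "J \<in> imag_units" "K \<in> imag_units" "Im z \<ge> 0" "p = slice_emb J z"
    "q = slice_emb K z" "p \<in> \<Omega>" "germ_eq J K z"
    using assms(1) unfolding linked_def by blast
  obtain w K' L where 2: "K' \<in> imag_units" "L \<in> imag_units" "Im w \<ge> 0" "q = slice_emb K' w"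
    "r = slice_emb L w" "r \<in> \<Omega>" "germ_eq K' L w"
    using assms(2) unfolding linked_def by blast
  have zw: "z = w" and "Im z = 0 \<or> K = K'"
    using slice_emb_unique[OF 1(2) 2(1) 1(3) 2(3)] 1 2 by auto
  then have "germ_eq J L z"
    using germ_eq_real[OF 1(1) 2(2)] germ_eq_trans 1 2 by blast
  then show ?thesis using 1 2 zw linkedI by blast
qed

text \<open>The germ is locally constant in the unit, by tubes, hence constant along a connected
  piece of the sphere; over a real point the sphere is a single point.\<close>

lemma linked_sphere:
  assumes q: "q \<in> connected_component_set (two_sphere p \<inter> \<Omega>) p" and p: "p \<in> \<Omega>"
  shows "linked p q"
proof -
  let ?C = "connected_component_set (two_sphere p \<inter> \<Omega>) p"
  obtain J z where z: "J \<in> imag_units" "Im z \<ge> 0" "p = slice_emb J z" using quat_slice_repr .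
  have C: "?C \<subseteq> two_sphere p \<inter> \<Omega>" by (rule connected_component_subset)
  have repr: "\<exists>K\<in>imag_units. a = slice_emb K z" if "a \<in> ?C" for a
    using that C z two_sphere_slice_emb[OF z(1,2)] by blast
  have "p \<in> ?C" using q by (metis connected_component_in connected_component_refl mem_Collect_eq)
  show ?thesis
  proof (cases "Im z = 0")
    case True
    then have "p = q" using repr[OF q] z by (auto simp: slice_emb_real)
    then show ?thesis using p linked_refl by simp
  next
    case False
    show ?thesis
    proof (rule connected_equivalence_relation[OF connected_connected_component \<open>p \<in> ?C\<close> q, where R = linked])
      fix a assume a: "a \<in> ?C"
      then obtain K where K: "K \<in> imag_units" "a = slice_emb K z" using repr by blast
      have "slice_emb K z \<in> \<Omega>" using a K C by blast
      then obtain e V where V: "z \<in> V" "tube \<Omega> K e V"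
        using tube_exists[OF speared K(1) z(2)] by blast
      \<comment> \<open>Distances on the sphere are \<open>Im z\<close> times those of the units, so
        this radius corresponds to the cap of radius \<open>e\<close>.\<close>
      have "linked a b" if b: "b \<in> ?C \<inter> ball a (Im z * e)" for b
      proof -
        obtain L where L: "L \<in> imag_units" "b = slice_emb L z" using repr b by blast
        have "L \<in> ball K e" using b False z(2) by (simp add: K L dist_slice_emb)
        then have "germ_eq K L z" using germ_eq_tube[OF V(2,1) K(1) L(1)] by blast
        moreover have "a \<in> \<Omega>" "b \<in> \<Omega>" using a b C by blast+
        ultimately show ?thesis using linkedI K L z by blast
      qed
      moreover have "a \<in> ball a (Im z * e)" using tubeD(1)[OF V(2)] False z(2) by simp
      moreover have "openin (top_of_set ?C) (?C \<inter> ball a (Im z * e))"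
        by (simp add: openin_open_Int)
      ultimately show "\<exists>T. openin (top_of_set ?C) T \<and> a \<in> T \<and> (\<forall>b\<in>T. linked a b)"
        using a by blast
    qed (use linked_sym linked_trans in blast)+
  qed
qed

text \<open>Equality of germs travels along the path in both directions, which is why an equivalence
  is obtained.\<close>

lemma linked_shadows:
  assumes "shadows \<Omega> x\<^sub>1 y\<^sub>1 x\<^sub>0 y\<^sub>0"
  shows "linked x\<^sub>0 x\<^sub>1 \<longleftrightarrow> linked y\<^sub>0 y\<^sub>1"
proof -
  obtain z z' J\<^sub>0 J\<^sub>1 \<gamma> where in\<Omega>: "{x\<^sub>0, x\<^sub>1, y\<^sub>0, y\<^sub>1} \<subseteq> \<Omega>"
    and J: "J\<^sub>0 \<in> imag_units" "J\<^sub>1 \<in> imag_units" and z: "Im z \<ge> 0" "Im z' \<ge> 0"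
    and eq: "x\<^sub>0 = slice_emb J\<^sub>0 z" "x\<^sub>1 = slice_emb J\<^sub>1 z" "y\<^sub>0 = slice_emb J\<^sub>0 z'" "y\<^sub>1 = slice_emb J\<^sub>1 z'"
    and \<gamma>: "path \<gamma>" "path_image \<gamma> \<subseteq> stem_E \<Omega> J\<^sub>0 J\<^sub>1" "pathstart \<gamma> = z" "pathfinish \<gamma> = z'"
    using assms unfolding shadows_def by blast
  have "connected (path_image \<gamma>)" "z \<in> path_image \<gamma>" "z' \<in> path_image \<gamma>"
    using \<gamma> by (auto intro: connected_path_image)
  then have "germ_eq J\<^sub>0 J\<^sub>1 z \<longleftrightarrow> germ_eq J\<^sub>0 J\<^sub>1 z'"
    using germ_eq_propagate[OF J _ \<gamma>(2)] by blast
  moreover have "linked x\<^sub>0 x\<^sub>1 \<longleftrightarrow> germ_eq J\<^sub>0 J\<^sub>1 z" "linked y\<^sub>0 y\<^sub>1 \<longleftrightarrow> germ_eq J\<^sub>0 J\<^sub>1 z'"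
    using in\<Omega> J z linkedD linkedI unfolding eq by blast+
  ultimately show ?thesis by simp
qed

text \<open>In the strongly hinged case, reflexivity at the real point \<open>y\<close> is carried
  back along the shadow.\<close>

lemma linked_simple_pair:
  assumes "simple_pair \<Omega> x s s'" "x s \<in> \<Omega>"
  shows "linked (x s) (x s')"
  using assms linked_sphere linked_shadows linked_refl
  unfolding simple_pair_def strongly_hinged_def by blast

lemma linked_simple_step:
  assumes "simple_step \<Omega> x t i" "x ` {0..t} \<subseteq> \<Omega>"
  shows "linked (x i) (x (Suc i))"
proof -
  obtain s s' where s: "s \<in> {0..t}" "\<bar>int s - int s'\<bar> = 1" "i = min s s'" "simple_pair \<Omega> x s s'"
    using assms(1) unfolding simple_step_def by blast
  have "linked (x s) (x s')" using linked_simple_pair s assms(2) by blast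
  moreover have "s = i \<and> s' = Suc i \<or> s' = i \<and> s = Suc i" using s by linarith
  ultimately show ?thesis using linked_sym by blast
qed

text \<open>The two steps are traversed in opposite directions, so shadowing pairs the inner ends
  \<open>Suc i\<close> and \<open>j\<close> with each other and likewise the outer ends
  \<open>i\<close> and \<open>Suc j\<close>. The subtraction of 1 in \<open>double_step\<close>
  turns the largest point index into the index of the later step.\<close>

lemma double_stepD:
  assumes "double_step \<Omega> x t i j"
  shows "i < j" "j < t" "linked (x (Suc i)) (x j) \<Longrightarrow> linked (x i) (x (Suc j))"
proof -
  obtain s s' s'' s''' where mem: "s \<in> {0..t}" "s' \<in> {0..t}" "s'' \<in> {0..t} - {s, s'}"
      "s''' \<in> {0..t} - {s, s'}"
    and diff: "\<bar>int s - int s'\<bar> = 1" "int s'' - int s''' = int s' - int s"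
    and sh: "shadows \<Omega> (x s'') (x s''') (x s) (x s')"
    and "i = Min {s, s', s'', s'''}" "j = Max {s, s', s'', s'''} - 1"
    using assms unfolding double_step_def by (elim bexE conjE)
  then have ij: "i = min s (min s' (min s'' s'''))" "j = max s (max s' (max s'' s''')) - 1"
    by simp_all
  consider "s' = Suc s" "s'' = Suc s'''" | "s = Suc s'" "s''' = Suc s''"
    using diff by linarith
  \<comment> \<open>The alternatives record which of the two steps comes first and in which
    direction it is traversed.\<close>
  then have cases: "s = i \<and> s' = Suc i \<and> s'' = Suc j \<and> s''' = j \<and> i < j \<or>
    s = j \<and> s' = Suc j \<and> s'' = Suc i \<and> s''' = i \<and> i < j \<or>
    s = Suc i \<and> s' = i \<and> s'' = j \<and> s''' = Suc j \<and> i < j \<or>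
    s = Suc j \<and> s' = j \<and> s'' = i \<and> s''' = Suc i \<and> i < j"
  proof cases
    case 1
    then show ?thesis
      unfolding ij using mem(3,4) by (cases "s < s'''") (simp_all add: min_def max_def)
  next
    case 2
    then show ?thesis
      unfolding ij using mem(3,4) by (cases "s' < s''") (simp_all add: min_def max_def)
  qed
  then show "i < j" "j < t" using mem by auto
  assume "linked (x (Suc i)) (x j)"
  then show "linked (x i) (x (Suc j))"
    using cases linked_shadows[OF sh] linked_sym by blast
qed

text \<open>The steps that are not simple are matched by \<open>a\<close> and \<open>b\<close>, and
  the whole range of steps is balanced, so the parenthesis induction runs from 0 to
  \<open>t\<close>.\<close>

lemma hinged_linked:
  assumes "hinged \<Omega> p p'"
  shows "linked p p'"
proof -
  obtain x t where chain: "hinge_chain \<Omega> x t" and x: "x 0 = p" "x t = p'"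
    using assms unfolding hinged_def by blast
  have sub: "x ` {0..t} \<subseteq> \<Omega>" using chain by (simp add: hinge_chain_def)
  obtain l :: nat and a b :: "nat \<Rightarrow> nat"
    where steps: "{0..t} - {t} - {s. simple_step \<Omega> x t s} = a ` {1..l} \<union> b ` {1..l}"
    and double: "\<forall>m\<in>{1..l}. double_step \<Omega> x t (a m) (b m)"
    and laminar: "\<forall>m\<in>{1..l}. \<forall>n\<in>{1..l}. m < n \<longrightarrow> a m < a n \<and> (b m < a n \<or> b m > b n)"
    using chain unfolding hinge_chain_def by (elim conjE exE) (rule that)
  note double = bspec[OF double]
  have "linked (x 0) (x t)"
  proof (rule balanced_steps_induct[where R = "\<lambda>i j. linked (x i) (x j)" and a=a and b=b and M="{1..l}" and t=t])
    show "linked (x i) (x i)" if "i \<le> t" for i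
      using that sub by (intro linked_refl) auto
    show "linked (x i) (x k)" if "linked (x i) (x j)" "linked (x j) (x k)" for i j k
      using that linked_trans by blast
    show "linked (x i) (x (Suc i))" if "i < t" "i \<notin> a ` {1..l} \<union> b ` {1..l}" for i
    proof -
      have "simple_step \<Omega> x t i" using that unfolding steps[symmetric] by auto
      then show ?thesis using linked_simple_step sub by blast
    qed
    show "a m < b m \<and> b m < t" if "m \<in> {1..l}" for m using double_stepD double that by blast
    show "linked (x (a m)) (x (Suc (b m)))"
      if "m \<in> {1..l}" "linked (x (Suc (a m))) (x (b m))" for m
      using double_stepD(3)[OF double] that by blast
    show "a m \<in> {0..<t} \<longleftrightarrow> b m \<in> {0..<t}" if "m \<in> {1..l}" for m
      using double_stepD(1,2)[OF double[OF that]] by simp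
  qed (use laminar in auto)
  then show ?thesis using x by simp
qed

end

theorem theorem5p9:
  fixes \<Omega> :: "quat set" and f :: "quat \<Rightarrow> quat"
    and \<alpha>\<^sub>0 \<beta>\<^sub>0 :: real and I I' :: quat
  assumes "speared_domain \<Omega>"
    and "slice_regular f \<Omega>"
    and "\<beta>\<^sub>0 \<ge> 0"
    and "I \<in> imag_units" and "I' \<in> imag_units"
    and "slice_emb I (Complex \<alpha>\<^sub>0 \<beta>\<^sub>0) \<in> \<Omega>"
    and "slice_emb I' (Complex \<alpha>\<^sub>0 \<beta>\<^sub>0) \<in> \<Omega>"
    and "hinged \<Omega> (slice_emb I (Complex \<alpha>\<^sub>0 \<beta>\<^sub>0)) (slice_emb I' (Complex \<alpha>\<^sub>0 \<beta>\<^sub>0))"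
  shows "\<exists>U. open U \<and> Complex \<alpha>\<^sub>0 \<beta>\<^sub>0 \<in> U \<and> U \<subseteq> stem_D \<Omega> I I' \<and>
           (\<forall>z\<in>U. stem_J \<Omega> f I z = stem_J \<Omega> f I' z) \<and>
           (\<forall>\<alpha> \<beta>. \<beta> \<ge> 0 \<and> Complex \<alpha> \<beta> \<in> U \<longrightarrow>
              spherical_value \<Omega> f (slice_emb I (Complex \<alpha> \<beta>)) =
                spherical_value \<Omega> f (slice_emb I' (Complex \<alpha> \<beta>)) \<and>
              (\<beta> > 0 \<longrightarrow>
                 spherical_deriv \<Omega> f (slice_emb I (Complex \<alpha> \<beta>)) =
                   spherical_deriv \<Omega> f (slice_emb I' (Complex \<alpha> \<beta>))))"
proof -
  interpret slice_function \<Omega> f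
    using assms by unfold_locales (simp_all add: speared_domain_def)
  note I = assms(4) and I' = assms(5)
  let ?z = "Complex \<alpha>\<^sub>0 \<beta>\<^sub>0"
  let ?W = "slice_dom \<Omega> {I, I'}"
  have "germ_eq I I' ?z"
    using linkedD[OF hinged_linked[OF assms(8)] I I'] assms(3) by simp
  then obtain G where G: "open G" "?z \<in> G" "\<And>w. w \<in> G \<Longrightarrow> stem_germ f I w = stem_germ f I' w"
    unfolding germ_eq_def eventually_nhds by blast
  have "open (G \<inter> ?W)" "?z \<in> G \<inter> ?W"
    using G assms(6,7) open_Omega by (auto simp: open_slice_dom) (simp add: slice_dom_def)
  then obtain r where r: "r > 0" "ball ?z r \<subseteq> G \<inter> ?W" using open_contains_ball by blast
  \<comment> \<open>The intersection with the open upper half plane is only taken off the real line; at a real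
    point the ball is invariant under conjugation.\<close>
  define U where "U = (if \<beta>\<^sub>0 = 0 then ball ?z r else ball ?z r \<inter> {w. Im w > 0})"
  have U: "open U" "?z \<in> U" "U \<subseteq> ball ?z r"
    using r assms(3) by (auto simp: U_def open_halfspace_Im_gt)
  have cnj: "cnj w \<in> U" if "w \<in> U" "Im w < 0" for w
  proof -
    have "\<beta>\<^sub>0 = 0" using that by (auto simp: U_def split: if_splits)
    moreover from this have "cnj ?z = ?z" by (simp add: complex_eq_iff)
    then have "dist ?z (cnj w) = dist ?z w"
      by (metis complex_cnj_diff complex_mod_cnj dist_norm)
    ultimately show ?thesis using that by (simp add: U_def)
  qed
  have W: "slice_emb I w \<in> \<Omega>" "slice_emb I' w \<in> \<Omega>" "stem_germ f I w = stem_germ f I' w" if "w \<in> U" for w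
    using that U(3) r(2) G(3) by (auto simp: slice_dom_def subset_iff)
  have E: "w \<in> stem_E \<Omega> I I'" if "w \<in> U" "Im w \<ge> 0" for w
    using that W by (simp add: stem_E_def slice_emb_in_half_slice)
  have "U \<subseteq> stem_D \<Omega> I I'"
  proof
    fix w assume "w \<in> U"
    then show "w \<in> stem_D \<Omega> I I'"
      using E[of w] E[of "cnj w"] cnj[of w] unfolding stem_D_def
      \<comment> \<open>Points below the real axis enter \<open>stem_D\<close> as conjugates of
        points of \<open>stem_E\<close>.\<close>
      by (cases "Im w \<ge> 0") (auto intro!: image_eqI[of w cnj "cnj w"])
  qed
  moreover have "stem_J \<Omega> f I w = stem_J \<Omega> f I' w" if "w \<in> U" for w
  proof (cases "Im w \<ge> 0")
    case True
    then show ?thesis using W[OF that] stem_J_eq_germ(1) I I' by simp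
  next
    case False
    then have "cnj w \<in> U" using cnj that by simp
    from W[OF this] show ?thesis
      using stem_J_eq_germ(2)[OF I, of "cnj w"] stem_J_eq_germ(2)[OF I', of "cnj w"] False by simp
  qed
  moreover have "spherical_value \<Omega> f (slice_emb I w) = spherical_value \<Omega> f (slice_emb I' w) \<and>
      (Im w > 0 \<longrightarrow> spherical_deriv \<Omega> f (slice_emb I w) = spherical_deriv \<Omega> f (slice_emb I' w))"
    if "w \<in> U" "Im w \<ge> 0" for w
  proof (cases "Im w = 0")
    \<comment> \<open>At a real \<open>w\<close> both embeddings are the same quaternion, so the
      germs need not be consulted.\<close>
    case True
    then show ?thesis by (simp add: slice_emb_real)
  next
    case False
    then show ?thesis
      using that W[OF that(1)] spherical_eq_germ[OF I, of w] spherical_eq_germ[OF I', of w] by simp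
  qed
  ultimately show ?thesis
    using U(1,2) by (intro exI[of _ U]) auto
qed

end
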